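(* Let $\Phi=\{\phi_j\}_{j=1}^N$ be a diagonal IFS of Lalley-Gatzouras type in $\mathbb{R}^d$ with attractor $\bar K$. If the fiber IFS $G(\emptyset)$ of the root has cardinality $N$ and has attractor $[0,1]$, and all the other fiber IFS (those of rank $\ge1$) have cardinality $1$, then $\bar K$ is minimal for conformal dimension; more precisely, $\dim_C\bar K=\dim_H\bar K=1$.
   Context: **IFS of Lalley-Gatzouras type.** A diagonal self-affine IFS on $\mathbb{R}^d$ ($d\ge 1$) is a finite family $\Phi=\{\phi_k\}_{k=1}^N$ of maps $\phi_k(x)=T_kx+b_k$ with $b_k\in\mathbb{R}^d$ and $T_k=\mathrm{diag}(T_{k,1},\dots,T_{k,d})$, $0<T_{k,i}<1$. Its attractor is the unique nonempty compact set $K\subset\mathbb{R}^d$ with $K=\bigcup_{k=1}^N\phi_k(K)$; it is always assumed that $K\subset[0,1]^d$. For $1\le i\le d$ let $\bar\pi_i(x_1,\dots,x_d)=(x_1,\dots,x_i)$ and let $\Phi_{\{1,\dots,i\}}$ be the set (each map counted once) of maps $y\mapsto \mathrm{diag}(T_{k,1},\dots,T_{k,i})y+\bar\pi_i(b_k)$ on $\mathbb{R}^i$, $1\le k\le N$. $\Phi$ satisfies the coordinate ordering condition if $T_{k,1}>T_{k,2}>\cdots>T_{k,d}$ for all $k$. $\Phi$ satisfies the neat projection condition if for each $1\le i\le d$ the IFS $\Phi_{\{1,\dots,i\}}$ satisfies the open set condition with the open unit cube $(0,1)^i$, i.e. $f((0,1)^i)\subset(0,1)^i$ for all $f\in\Phi_{\{1,\dots,i\}}$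 and the sets $f((0,1)^i)$, $f\in\Phi_{\{1,\dots,i\}}$, are pairwise disjoint. $\Phi$ is of Lalley-Gatzouras type if both conditions hold. The attractor carries the Euclidean metric. **Fiber IFS.** The fiber IFS of the root is $G(\emptyset)=\Phi_{\{1\}}$. For $1\le\ell\le d-1$ and $u\in\Phi_{\{1,\dots,\ell\}}$, the set $G(u)=\{h:\ (u,h)\in\Phi_{\{1,\dots,\ell+1\}}\}$ is called a fiber IFS of rank $\ell$; here $h(x)=ax+b$ with $0<a<1$ and $(u,h)(x_1,\dots,x_{\ell+1})=(u(x_1,\dots,x_\ell),h(x_{\ell+1}))$. Each fiber IFS is a finite IFS of affine contractions mapping $[0,1]$ into itself. **Conformal dimension.** Given a homeomorphism $\eta:[0,\infty)\to[0,\infty)$, an injective map $f:(X,d_X)\to(Y,d_Y)$ between metric spaces is $\eta$-quasisymmetric if for all distinct triples $x,y,z\in X$ and all $t>0$, $\frac{d_X(x,y)}{d_X(y,z)}\le t$ implies $\frac{d_Y(f(x),f(y))}{d_Y(f(y),f(z))}\le\eta(t)$; it is quasisymmetric if this holds for some $\eta$. The conformal dimension is $\dim_C X=\inf \dim_H f(X)$, the infimum over all quasisymmetric maps $f$ defined on $X$ (into arbitrary metric spaces), where $\dim_H$ is Hausdorff dimension. $X$ is minimal for conformal dimension if $\dim_C X=\dim_H X$. *)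

theory Defs
  imports "HOL-Analysis.Analysis"
begin

section \<open>Hausdorff dimension and conformal dimension of metric spaces\<close>

definition set_diameter :: "'a metric \<Rightarrow> 'a set \<Rightarrow> ennreal" where
  "set_diameter m U = (SUP x\<in>U. SUP y\<in>U. ennreal (mdist m x y))"

text \<open>\<open>s\<close>-dimensional Hausdorff pre-measure at scale \<open>\<delta>\<close>. The covering sets have finite
  diameter, so nothing is lost by \<open>enn2real\<close>.\<close>

definition hausdorff_premeasure :: "'a metric \<Rightarrow> real \<Rightarrow> real \<Rightarrow> 'a set \<Rightarrow> ennreal" where
  "hausdorff_premeasure m s \<delta> A =
     Inf {(\<Sum>i. ennreal (enn2real (set_diameter m (U i)) powr s)) | U :: nat \<Rightarrow> 'a set.
            A \<subseteq> (\<Union>i. U i) \<and> (\<forall>i. U i \<subseteq> mspace m \<and> set_diameter m (U i) \<le> ennreal \<delta>)}"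

definition hausdorff_outer :: "'a metric \<Rightarrow> real \<Rightarrow> 'a set \<Rightarrow> ennreal" where
  "hausdorff_outer m s A = (SUP \<delta>\<in>{0<..}. hausdorff_premeasure m s \<delta> A)"

text \<open>Only exponents \<open>s > 0\<close> are used, which avoids the convention for \<open>0 powr 0\<close> and does
  not change the infimum.\<close>

definition hausdorff_dim :: "'a metric \<Rightarrow> 'a set \<Rightarrow> ennreal" where
  "hausdorff_dim m A = Inf {ennreal s | s. 0 < s \<and> hausdorff_outer m s A = 0}"

definition quasisymmetric_map :: "'a metric \<Rightarrow> 'b metric \<Rightarrow> ('a \<Rightarrow> 'b) \<Rightarrow> bool" where
  "quasisymmetric_map X Y f \<longleftrightarrow>
     f \<in> mspace X \<rightarrow> mspace Y \<and> inj_on f (mspace X) \<and>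
     (\<exists>\<eta> \<eta>'. homeomorphism {0::real..} {0..} \<eta> \<eta>' \<and>
        (\<forall>x\<in>mspace X. \<forall>y\<in>mspace X. \<forall>z\<in>mspace X. \<forall>t>0.
           x \<noteq> y \<longrightarrow> y \<noteq> z \<longrightarrow> x \<noteq> z \<longrightarrow>
           mdist X x y / mdist X y z \<le> t \<longrightarrow>
           mdist Y (f x) (f y) / mdist Y (f y) (f z) \<le> \<eta> t))"

text \<open>HOL cannot quantify over the type of the points of the target space. Since quasisymmetric
  maps are injective, every image \<open>f(X)\<close> is isometric to a metric space whose points are those of
  \<open>X\<close>, so target spaces over the same type suffice; the lemma \<open>conformal_dim_le\<close> below shows that
  no target space over any other type gives a smaller value.\<close>

definition conformal_dim :: "'a metric \<Rightarrow> ennreal" where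
  "conformal_dim X =
     Inf {hausdorff_dim Y (f ` mspace X) | (Y :: 'a metric) f. quasisymmetric_map X Y f}"

definition minimal_for_conformal_dim :: "'a metric \<Rightarrow> bool" where
  "minimal_for_conformal_dim X \<longleftrightarrow> conformal_dim X = hausdorff_dim X (mspace X)"

lemma set_diameter_le:
  assumes "\<And>x y. x \<in> U \<Longrightarrow> y \<in> U \<Longrightarrow> f x \<in> V \<and> f y \<in> V \<and> mdist m x y = mdist m' (f x) (f y)"
  shows "set_diameter m U \<le> set_diameter m' V"
  unfolding set_diameter_def
proof (intro SUP_least)
  fix x y assume "x \<in> U" "y \<in> U"
  with assms have *: "f x \<in> V" "f y \<in> V" "mdist m x y = mdist m' (f x) (f y)"
    by auto
  show "ennreal (mdist m x y) \<le> (SUP x\<in>V. SUP y\<in>V. ennreal (mdist m' x y))"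
    unfolding *(3) by (rule SUP_upper2[OF *(1)], rule SUP_upper2[OF *(2)]) simp
qed

lemma hausdorff_dim_isometric_le:
  assumes dist: "\<And>x y. x \<in> mspace m \<Longrightarrow> y \<in> mspace m \<Longrightarrow> mdist m x y = mdist m' (f x) (f y)"
    and A: "A \<subseteq> mspace m"
  shows "hausdorff_dim m A \<le> hausdorff_dim m' (f ` A)"
proof -
  have pre: "hausdorff_premeasure m s \<delta> A \<le> hausdorff_premeasure m' s \<delta> (f ` A)"
    if "0 < s" for s \<delta>
    unfolding hausdorff_premeasure_def
  proof (rule Inf_mono, clarify)
    fix V :: "nat \<Rightarrow> 'b set"
    assume V: "f ` A \<subseteq> \<Union> (range V)"
      and small: "\<forall>i. V i \<subseteq> mspace m' \<and> set_diameter m' (V i) \<le> ennreal \<delta>"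
    define U where "U i = {x \<in> mspace m. f x \<in> V i}" for i
    have le: "set_diameter m (U i) \<le> set_diameter m' (V i)" for i
      by (rule set_diameter_le[where f = f]) (auto simp: U_def dist)
    have fin: "set_diameter m' (V i) < top" for i
      using small ennreal_less_top le_less_trans by blast
    have "ennreal (enn2real (set_diameter m (U i)) powr s)
        \<le> ennreal (enn2real (set_diameter m' (V i)) powr s)" for i
      using that le[of i] fin[of i] by (intro ennreal_leI powr_mono2 enn2real_mono) auto
    then have "(\<Sum>i. ennreal (enn2real (set_diameter m (U i)) powr s))
        \<le> (\<Sum>i. ennreal (enn2real (set_diameter m' (V i)) powr s))"
      by (intro suminf_le) auto
    moreover have "A \<subseteq> \<Union> (range U)"
      using V A unfolding U_def by blast
    moreover have "\<forall>i. U i \<subseteq> mspace m \<and> set_diameter m (U i) \<le> ennreal \<delta>"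
      using le small by (auto simp: U_def intro: order_trans)
    ultimately show "\<exists>a\<in>{(\<Sum>i. ennreal (enn2real (set_diameter m (U i)) powr s)) | U.
              A \<subseteq> \<Union> (range U) \<and>
              (\<forall>i. U i \<subseteq> mspace m \<and> set_diameter m (U i) \<le> ennreal \<delta>)}.
        a \<le> (\<Sum>i. ennreal (enn2real (set_diameter m' (V i)) powr s))"
      by blast
  qed
  have outer: "hausdorff_outer m s A \<le> hausdorff_outer m' s (f ` A)" if "0 < s" for s
    unfolding hausdorff_outer_def by (intro SUP_mono) (use pre[OF that] in blast)
  have "hausdorff_outer m s A = 0" if "0 < s" "hausdorff_outer m' s (f ` A) = 0" for s
    using outer[OF that(1)] that(2) by simp
  then show ?thesis
    unfolding hausdorff_dim_def by (intro Inf_superset_mono) blast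
qed

lemma conformal_dim_le:
  fixes X :: "'a metric" and Y :: "'b metric"
  assumes "quasisymmetric_map X Y f"
  shows "conformal_dim X \<le> hausdorff_dim Y (f ` mspace X)"
proof -
  have f: "f \<in> mspace X \<rightarrow> mspace Y" "inj_on f (mspace X)"
    using assms by (auto simp: quasisymmetric_map_def)
  interpret Z: Metric_space "mspace X" "\<lambda>x y. mdist Y (f x) (f y)"
  proof
    fix x y z assume "x \<in> mspace X" "y \<in> mspace X"
    with f have fxy: "f x \<in> mspace Y" "f y \<in> mspace Y" by auto
    show "mdist Y (f x) (f y) = 0 \<longleftrightarrow> x = y"
      using fxy f(2) \<open>x \<in> mspace X\<close> \<open>y \<in> mspace X\<close> by (auto dest: inj_onD)
    assume "z \<in> mspace X"
    with f have "f z \<in> mspace Y" by auto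
    with fxy show "mdist Y (f x) (f z) \<le> mdist Y (f x) (f y) + mdist Y (f y) (f z)"
      by (intro mdist_triangle)
  qed (auto simp: mdist_commute)
  define Z where "Z = metric (mspace X, \<lambda>x y. mdist Y (f x) (f y))"
  have Z: "mspace Z = mspace X" "mdist Z = (\<lambda>x y. mdist Y (f x) (f y))"
    by (simp_all add: Z_def)
  have "quasisymmetric_map X Z id"
    using assms unfolding quasisymmetric_map_def Z by auto
  then have "conformal_dim X \<le> hausdorff_dim Z (id ` mspace X)"
    unfolding conformal_dim_def by (intro Inf_lower) blast
  also have "\<dots> \<le> hausdorff_dim Y (f ` mspace X)"
    using hausdorff_dim_isometric_le[of Z Y f "mspace X"] by (simp add: Z)
  finally show ?thesis .
qed

section \<open>Diagonal iterated function systems of Lalley--Gatzouras type\<close>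

text \<open>Points of \<open>\<real>\<^sup>n\<close> are the elements of \<open>topspace (Euclidean_space n)\<close>, that is,
  functions \<open>x :: nat \<Rightarrow> real\<close> with \<open>x i = 0\<close> for \<open>i \<ge> n\<close>. Hence coordinates are numbered
  from \<open>0\<close>.\<close>

definition Rn_metric :: "nat \<Rightarrow> (nat \<Rightarrow> real) metric" where
  "Rn_metric n = metric (topspace (Euclidean_space n), \<lambda>x y. L2_set (\<lambda>i. x i - y i) {..<n})"

lemma Metric_space_Rn:
  "Metric_space (topspace (Euclidean_space n)) (\<lambda>x y. L2_set (\<lambda>i. x i - y i) {..<n})"
proof
  fix x y z :: "nat \<Rightarrow> real"
  show "L2_set (\<lambda>i. x i - y i) {..<n} = L2_set (\<lambda>i. y i - x i) {..<n}"
    by (simp add: L2_set_def power2_commute)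
  show "L2_set (\<lambda>i. x i - z i) {..<n}
      \<le> L2_set (\<lambda>i. x i - y i) {..<n} + L2_set (\<lambda>i. y i - z i) {..<n}"
    using L2_set_triangle_ineq[of "\<lambda>i. x i - y i" "\<lambda>i. y i - z i" "{..<n}"] by simp
  assume "x \<in> topspace (Euclidean_space n)" "y \<in> topspace (Euclidean_space n)"
  then show "L2_set (\<lambda>i. x i - y i) {..<n} = 0 \<longleftrightarrow> x = y"
    by (auto simp: L2_set_eq_0_iff topspace_Euclidean_space fun_eq_iff) (metis lessThan_iff not_less)
qed simp

lemma mspace_Rn [simp]: "mspace (Rn_metric n) = topspace (Euclidean_space n)"
  and mdist_Rn [simp]: "mdist (Rn_metric n) = (\<lambda>x y. L2_set (\<lambda>i. x i - y i) {..<n})"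
  using Metric_space_Rn[of n]
  by (simp_all add: Rn_metric_def Metric_space.mspace_metric Metric_space.mdist_metric)

lemma mtopology_of_Rn: "mtopology_of (Rn_metric n) = Euclidean_space n"
proof -
  interpret E: Metric_space "topspace (Euclidean_space n)" "\<lambda>x y. L2_set (\<lambda>i. x i - y i) {..<n}"
    by (rule Metric_space_Rn)
  have mt: "mtopology_of (Rn_metric n) = E.mtopology"
    by (simp add: mtopology_of_def)
  have coord: "continuous_map (mtopology_of (Rn_metric n)) euclideanreal (\<lambda>x. x i)" if "i < n" for i
  proof -
    have "\<bar>x i - y i\<bar> \<le> L2_set (\<lambda>i. x i - y i) {..<n}" for x y :: "nat \<Rightarrow> real"
      using member_le_L2_set[of "{..<n}" i "\<lambda>i. \<bar>x i - y i\<bar>"] that by (simp add: L2_set_def)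
    then have "Lipschitz_continuous_map (Rn_metric n) euclidean_metric (\<lambda>x. x i)"
      unfolding Lipschitz_continuous_map_def by (auto intro!: exI[of _ 1] simp: dist_real_def)
    then show ?thesis
      using Lipschitz_continuous_imp_continuous_map by fastforce
  qed
  have "continuous_map (mtopology_of (Rn_metric n)) (Euclidean_space n) (\<lambda>x i. if i < n then x i else 0)"
    using coord unfolding continuous_map_componentwise_Euclidean_space by auto
  then have id1: "continuous_map (mtopology_of (Rn_metric n)) (Euclidean_space n) id"
    apply (rule continuous_map_eq)
    by (auto simp: topspace_Euclidean_space fun_eq_iff)
  have "continuous_map (Euclidean_space n) E.mtopology id"
    unfolding E.continuous_map_to_metric
  proof (intro ballI)
    fix x assume x: "x \<in> topspace (Euclidean_space n)" 
    show "\<forall>e>0. \<exists>U. openin (Euclidean_space n) U \<and> x \<in> U \<and> (\<forall>y\<in>U. id y \<in> E.mball (id x) e)"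
    proof (intro allI impI)
      fix e :: real assume "0 < e"
      have "continuous_on UNIV (\<lambda>y. L2_set (\<lambda>i. x i - (y::nat\<Rightarrow>real) i) {..<n})"
        unfolding L2_set_def by (intro continuous_intros continuous_on_product_coordinates)
      then have "continuous_map (Euclidean_space n) euclidean (\<lambda>y. L2_set (\<lambda>i. x i - y i) {..<n})"
        unfolding continuous_map_Euclidean_space_iff using continuous_on_subset by blast
      then have "openin (Euclidean_space n) {y \<in> topspace (Euclidean_space n). L2_set (\<lambda>i. x i - y i) {..<n} \<in> {..<e}}"
        by (rule openin_continuous_map_preimage) auto
      moreover have "x \<in> {y \<in> topspace (Euclidean_space n). L2_set (\<lambda>i. x i - y i) {..<n} \<in> {..<e}}"
        using x \<open>0 < e\<close> by (simp add: L2_set_0')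
      ultimately show "\<exists>U. openin (Euclidean_space n) U \<and> x \<in> U \<and> (\<forall>y\<in>U. id y \<in> E.mball (id x) e)"
        using x by (intro exI conjI) (assumption, assumption, auto)
    qed
  qed
  then have id2: "continuous_map (Euclidean_space n) (mtopology_of (Rn_metric n)) id"
    by (simp add: mt)
  have top: "topspace (mtopology_of (Rn_metric n)) = topspace (Euclidean_space n)"
    by (simp add: mt)
  show ?thesis
    using topology_finer_continuous_id[OF top] topology_finer_continuous_id[OF top[symmetric]] id1 id2
    unfolding topology_eq by blast
qed

definition open_cube :: "nat \<Rightarrow> (nat \<Rightarrow> real) set" where
  "open_cube n = {x \<in> topspace (Euclidean_space n). \<forall>i<n. 0 < x i \<and> x i < 1}"

definition closed_cube :: "nat \<Rightarrow> (nat \<Rightarrow> real) set" where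
  "closed_cube n = {x \<in> topspace (Euclidean_space n). \<forall>i<n. 0 \<le> x i \<and> x i \<le> 1}"

text \<open>Both \<open>diag_map n t b\<close> and \<open>product_map l u h\<close> depend only on the coordinates of the
  argument below the relevant dimension and produce points of that Euclidean space. Thus two such
  maps are equal in HOL iff they agree as maps on that space, and sets of them count each map
  once.\<close>

definition diag_map :: "nat \<Rightarrow> (nat \<Rightarrow> real) \<Rightarrow> (nat \<Rightarrow> real) \<Rightarrow> (nat \<Rightarrow> real) \<Rightarrow> (nat \<Rightarrow> real)" where
  "diag_map n t b x = (\<lambda>i. if i < n then t i * x i + b i else 0)"

definition coord_proj :: "nat \<Rightarrow> (nat \<Rightarrow> real) \<Rightarrow> (nat \<Rightarrow> real)" where
  "coord_proj n x = (\<lambda>i. if i < n then x i else 0)"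

text \<open>The map \<open>(u, h)\<close> on \<open>\<real>\<^sup>l \<times> \<real>\<close> for \<open>u\<close> acting on \<open>\<real>\<^sup>l\<close> and \<open>h\<close> acting on \<open>\<real>\<close>.\<close>

definition product_map ::
  "nat \<Rightarrow> ((nat \<Rightarrow> real) \<Rightarrow> (nat \<Rightarrow> real)) \<Rightarrow> (real \<Rightarrow> real) \<Rightarrow> (nat \<Rightarrow> real) \<Rightarrow> (nat \<Rightarrow> real)" where
  "product_map l u h x =
     (\<lambda>i. if i < l then u (coord_proj l x) i else if i = l then h (x l) else 0)"

definition is_attractor ::
  "nat \<Rightarrow> ((nat \<Rightarrow> real) \<Rightarrow> (nat \<Rightarrow> real)) set \<Rightarrow> (nat \<Rightarrow> real) set \<Rightarrow> bool" where
  "is_attractor n F K \<longleftrightarrow> K \<noteq> {} \<and> compactin (Euclidean_space n) K \<and> K = (\<Union>f\<in>F. f ` K)"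

text \<open>A diagonal IFS on \<open>\<real>\<^sup>d\<close> with \<open>N\<close> maps is given by the diagonal entries \<open>T k i\<close> and the
  translation vectors \<open>b k\<close>, for \<open>k < N\<close> and \<open>i < d\<close>; its maps are \<open>diag_map d (T k) (b k)\<close>.\<close>

definition diagonal_IFS :: "nat \<Rightarrow> nat \<Rightarrow> (nat \<Rightarrow> nat \<Rightarrow> real) \<Rightarrow> (nat \<Rightarrow> nat \<Rightarrow> real) \<Rightarrow> bool" where
  "diagonal_IFS d N T b \<longleftrightarrow>
     1 \<le> d \<and> 1 \<le> N \<and> (\<forall>k<N. b k \<in> topspace (Euclidean_space d)) \<and>
     (\<forall>k<N. \<forall>i<d. 0 < T k i \<and> T k i < 1)"

text \<open>The IFS on \<open>\<real>\<^sup>i\<close> of the first \<open>i\<close> coordinates; for \<open>i = d\<close> this is the set of all maps of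
  the given IFS.\<close>

definition proj_IFS ::
  "nat \<Rightarrow> (nat \<Rightarrow> nat \<Rightarrow> real) \<Rightarrow> (nat \<Rightarrow> nat \<Rightarrow> real) \<Rightarrow> nat
     \<Rightarrow> ((nat \<Rightarrow> real) \<Rightarrow> (nat \<Rightarrow> real)) set" where
  "proj_IFS N T b i = (\<lambda>k. diag_map i (T k) (coord_proj i (b k))) ` {..<N}"

definition coordinate_ordering :: "nat \<Rightarrow> nat \<Rightarrow> (nat \<Rightarrow> nat \<Rightarrow> real) \<Rightarrow> bool" where
  "coordinate_ordering d N T \<longleftrightarrow> (\<forall>k<N. \<forall>i. Suc i < d \<longrightarrow> T k i > T k (Suc i))"

definition neat_projection ::
  "nat \<Rightarrow> nat \<Rightarrow> (nat \<Rightarrow> nat \<Rightarrow> real) \<Rightarrow> (nat \<Rightarrow> nat \<Rightarrow> real) \<Rightarrow> bool" where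
  "neat_projection d N T b \<longleftrightarrow>
     (\<forall>i\<in>{1..d}. (\<forall>f\<in>proj_IFS N T b i. f ` open_cube i \<subseteq> open_cube i) \<and>
        disjoint_family_on (\<lambda>f. f ` open_cube i) (proj_IFS N T b i))"

definition lalley_gatzouras ::
  "nat \<Rightarrow> nat \<Rightarrow> (nat \<Rightarrow> nat \<Rightarrow> real) \<Rightarrow> (nat \<Rightarrow> nat \<Rightarrow> real) \<Rightarrow> bool" where
  "lalley_gatzouras d N T b \<longleftrightarrow>
     diagonal_IFS d N T b \<and> coordinate_ordering d N T \<and> neat_projection d N T b"

text \<open>The fiber IFS at \<open>u \<in> proj_IFS N T b l\<close>, of rank \<open>l \<ge> 1\<close>. The fiber IFS of the root is
  \<open>proj_IFS N T b 1\<close>.\<close>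

definition fiber_IFS ::
  "nat \<Rightarrow> (nat \<Rightarrow> nat \<Rightarrow> real) \<Rightarrow> (nat \<Rightarrow> nat \<Rightarrow> real) \<Rightarrow> nat
     \<Rightarrow> ((nat \<Rightarrow> real) \<Rightarrow> (nat \<Rightarrow> real)) \<Rightarrow> (real \<Rightarrow> real) set" where
  "fiber_IFS N T b l u =
     {h. (\<exists>a c. 0 < a \<and> a < 1 \<and> h = (\<lambda>x. a * x + c)) \<and>
         product_map l u h \<in> proj_IFS N T b (Suc l)}"

end

theory Submission
  imports Defs "HOL-Library.Sublist"
begin

text \<open>
  The first coordinate maps \<open>K\<close> onto \<open>[0,1]\<close>, and by the coordinate ordering a cylinder of level
  \<open>n\<close> and width \<open>W\<close> has extent at most \<open>\<theta>\<^sup>n W\<close> in the other directions, with \<open>\<theta> < 1\<close>.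
  Covering \<open>K\<close> by cylinders gives dimension at most \<open>1\<close>.

  Let \<open>f\<close> be quasisymmetric and let \<open>D w\<close> be the diameter of the image of the cylinder \<open>w\<close>. Two
  points of the cylinder with the same first coordinate are so close that their images are at
  distance at most \<open>\<epsilon> D w\<close>, with \<open>\<epsilon> \<rightarrow> 0\<close> as the level grows. By the triangle inequality the
  diameters of the images of the children of \<open>w\<close> then add up to at least \<open>(1 - o(1)) D w\<close>, although
  \<open>K\<close> may be totally disconnected. Since \<open>D w\<close> decays exponentially in the level, for each \<open>s < 1\<close>
  the sum of \<open>(D w)\<^sup>s\<close> over any finite set of long words that covers \<open>K\<close> is bounded below by a
  positive constant. A set in the image is covered by boundedly many image cylinders of comparable
  diameter, so the \<open>s\<close>-dimensional Hausdorff measure of the image is positive.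
\<close>

section \<open>Preliminaries\<close>

text \<open>Lebesgue measure is additive over the disjoint open intervals and monotone, so the
  intervals never have to be put in order.\<close>

lemma sum_length_disjoint_intervals_le:
  fixes lo hi :: "'i \<Rightarrow> real"
  assumes "finite F" "a \<le> b"
    and sub: "\<And>i. i \<in> F \<Longrightarrow> a \<le> lo i \<and> lo i \<le> hi i \<and> hi i \<le> b"
    and disj: "disjoint_family_on (\<lambda>i. {lo i<..<hi i}) F"
  shows "(\<Sum>i\<in>F. hi i - lo i) \<le> b - a"
proof -
  have "(\<Sum>i\<in>F. hi i - lo i) = (\<Sum>i\<in>F. measure lborel {lo i<..<hi i})"
    using sub by (intro sum.cong) auto
  also have "\<dots> = measure lborel (\<Union>i\<in>F. {lo i<..<hi i})"
    using assms sub by (intro measure_finite_Union[symmetric]) auto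
  also have "\<dots> \<le> measure lborel {a..b}"
  proof (rule measure_mono_fmeasurable)
    show "(\<Union>i\<in>F. {lo i<..<hi i}) \<subseteq> {a..b}"
    proof clarify
      fix i x assume "i \<in> F" "x \<in> {lo i<..<hi i}"
      then show "x \<in> {a..b}" using sub[of i] by auto
    qed
    show "(\<Union>i\<in>F. {lo i<..<hi i}) \<in> sets lborel"
      by (simp add: borel_open open_UN)
  qed (simp add: fmeasurable_def emeasure_lborel_Icc_eq)
  also have "\<dots> = b - a" using \<open>a \<le> b\<close> by simp
  finally show ?thesis .
qed

text \<open>A zero \<open>a > 0\<close> would be an interior minimum. By the intermediate value
  theorem some value \<open>c > 0\<close> is then taken both on \<open>[0, a]\<close> and on
  \<open>[a, 2 * a]\<close>, against injectivity.\<close>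

lemma homeomorphism_half_line_0:
  fixes \<eta> \<eta>' :: "real \<Rightarrow> real"
  assumes "homeomorphism {0..} {0..} \<eta> \<eta>'"
  shows "\<eta> 0 = 0"
proof (rule ccontr)
  assume ne: "\<eta> 0 \<noteq> 0"
  note cont = homeomorphism_cont1[OF assms] and im = homeomorphism_image1[OF assms]
  have inj: "x = y" if "0 \<le> x" "0 \<le> y" "\<eta> x = \<eta> y" for x y
    using homeomorphism_apply1[OF assms, THEN sym, of x] homeomorphism_apply1[OF assms, of y] that
    by (metis atLeast_iff)
  have nonneg: "0 \<le> \<eta> x" if "0 \<le> x" for x using im that by (metis atLeast_iff imageI)
  have "0 \<in> \<eta> ` {0..}" by (simp add: im)
  then obtain a where a: "0 \<le> a" "\<eta> a = 0" by auto
  with ne have "0 < a" by (cases "a = 0") auto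
  define c where "c = min (\<eta> 0) (\<eta> (2 * a))"
  have "\<eta> (2 * a) \<noteq> 0" using inj[of "2 * a" a] a \<open>0 < a\<close> by auto
  then have c: "0 < c" "c \<le> \<eta> 0" "c \<le> \<eta> (2 * a)"
    using ne nonneg[of 0] nonneg[of "2 * a"] a by (auto simp: c_def)
  have "\<exists>x\<ge>0. x \<le> a \<and> \<eta> x = c"
    using a c by (intro IVT2') (auto intro: continuous_on_subset[OF cont])
  moreover have "\<exists>x\<ge>a. x \<le> 2 * a \<and> \<eta> x = c"
    using a c by (intro IVT') (auto intro: continuous_on_subset[OF cont])
  ultimately obtain x y where xy: "0 \<le> x" "x \<le> a" "a \<le> y" "\<eta> x = c" "\<eta> y = c" by blast
  with inj[of x y] a have "x = a" by auto
  with xy a c show False by simp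
qed

section \<open>Quasisymmetric maps\<close>

lemma mdist_self [simp]: "x \<in> mspace X \<Longrightarrow> mdist X x x = 0"
  by simp

text \<open>Both quotients are multiplied out; injectivity of \<open>f\<close> makes the denominator
  in the target positive.\<close>

lemma quasisymmetric_mapE:
  assumes "quasisymmetric_map X Y f"
  obtains \<eta> \<eta>' where "homeomorphism {0::real..} {0..} \<eta> \<eta>'"
    and "\<forall>x\<in>mspace X. \<forall>y\<in>mspace X. \<forall>z\<in>mspace X. \<forall>t>0.
           x \<noteq> y \<longrightarrow> y \<noteq> z \<longrightarrow> x \<noteq> z \<longrightarrow> mdist X x y \<le> t * mdist X y z \<longrightarrow>
           mdist Y (f x) (f y) \<le> \<eta> t * mdist Y (f y) (f z)"
    and "f \<in> mspace X \<rightarrow> mspace Y" "inj_on f (mspace X)"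
  using assms unfolding quasisymmetric_map_def
proof (elim conjE exE)
  fix \<eta> \<eta>' assume hom: "homeomorphism {0::real..} {0..} \<eta> \<eta>'"
    and \<eta>: "\<forall>x\<in>mspace X. \<forall>y\<in>mspace X. \<forall>z\<in>mspace X. \<forall>t>0.
           x \<noteq> y \<longrightarrow> y \<noteq> z \<longrightarrow> x \<noteq> z \<longrightarrow> mdist X x y / mdist X y z \<le> t \<longrightarrow>
           mdist Y (f x) (f y) / mdist Y (f y) (f z) \<le> \<eta> t"
    and f: "f \<in> mspace X \<rightarrow> mspace Y" "inj_on f (mspace X)"
  show thesis
  proof (rule that[OF hom _ f], intro ballI allI impI)
    fix x y z t assume xyz: "x \<in> mspace X" "y \<in> mspace X" "z \<in> mspace X"
      and t: "0 < t" "x \<noteq> y" "y \<noteq> z" "x \<noteq> z" "mdist X x y \<le> t * mdist X y z"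
    have "0 < mdist X y z" using xyz \<open>y \<noteq> z\<close> by (simp add: less_le)
    then have "mdist X x y / mdist X y z \<le> t" using t(5) by (simp add: pos_divide_le_eq)
    then have "mdist Y (f x) (f y) / mdist Y (f y) (f z) \<le> \<eta> t"
      by (rule \<eta>[rule_format, OF xyz t(1-4)])
    moreover have "0 < mdist Y (f y) (f z)"
      using \<open>y \<noteq> z\<close> xyz f by (auto simp: less_le Pi_iff dest: inj_onD)
    ultimately show "mdist Y (f x) (f y) \<le> \<eta> t * mdist Y (f y) (f z)"
      by (simp add: pos_divide_le_eq)
  qed
qed

text \<open>Since \<open>\<eta>\<close> is continuous at 0 with \<open>\<eta> 0 = 0\<close>, small
  ratios go to small ratios. Points may coincide here, which spares case distinctions later.\<close>

lemma quasisymmetric_map_small: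
  assumes "quasisymmetric_map X Y f" and "0 < \<epsilon>"
  shows "\<exists>t>0. \<forall>x\<in>mspace X. \<forall>y\<in>mspace X. \<forall>z\<in>mspace X.
    mdist X x y \<le> t * mdist X y z \<longrightarrow> mdist Y (f x) (f y) \<le> \<epsilon> * mdist Y (f y) (f z)"
proof -
  from assms(1) obtain \<eta> \<eta>' where hom: "homeomorphism {0::real..} {0..} \<eta> \<eta>'"
    and \<eta>: "\<forall>x\<in>mspace X. \<forall>y\<in>mspace X. \<forall>z\<in>mspace X. \<forall>t>0.
           x \<noteq> y \<longrightarrow> y \<noteq> z \<longrightarrow> x \<noteq> z \<longrightarrow> mdist X x y \<le> t * mdist X y z \<longrightarrow>
           mdist Y (f x) (f y) \<le> \<eta> t * mdist Y (f y) (f z)"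
    and f: "f \<in> mspace X \<rightarrow> mspace Y" "inj_on f (mspace X)"
    by (rule quasisymmetric_mapE)
  have "continuous_on {0..} \<eta>" using hom by (rule homeomorphism_cont1)
  then have "\<forall>\<epsilon>>0. \<exists>\<delta>>0. \<forall>x\<in>{0..}. dist x 0 < \<delta> \<longrightarrow> dist (\<eta> x) (\<eta> 0) < \<epsilon>"
    unfolding continuous_on_iff by (rule bspec) simp
  with \<open>0 < \<epsilon>\<close> obtain \<delta> where \<delta>: "0 < \<delta>" "\<forall>x\<in>{0..}. dist x 0 < \<delta> \<longrightarrow> dist (\<eta> x) (\<eta> 0) < \<epsilon>"
    by blast
  \<comment> \<open>Besides \<open>t < \<delta>\<close>, the bound \<open>t < 1\<close> matters: it
    excludes \<open>x = z\<close> with \<open>x \<noteq> y\<close>, a case on which the definition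
    of quasisymmetry is silent.\<close>
  define t where "t = min (\<delta> / 2) (1 / 2)"
  have t: "0 < t" "t < \<delta>" "t < 1" using \<delta>(1) by (auto simp: t_def min_def)
  have "dist (\<eta> t) (\<eta> 0) < \<epsilon>" using \<delta>(2) t by (simp add: dist_real_def)
  then have \<eta>t: "\<eta> t \<le> \<epsilon>"
    using homeomorphism_half_line_0[OF hom] by (simp add: dist_real_def)
  show ?thesis
  proof (intro exI[of _ t] conjI ballI impI)
    fix x y z assume xyz: "x \<in> mspace X" "y \<in> mspace X" "z \<in> mspace X"
      and le: "mdist X x y \<le> t * mdist X y z"
    show "mdist Y (f x) (f y) \<le> \<epsilon> * mdist Y (f y) (f z)"
    proof (cases "x = y")
      case True
      then have "mdist Y (f x) (f y) = 0" using f xyz by (auto simp: Pi_iff)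
      then show ?thesis using \<open>0 < \<epsilon>\<close> by simp
    next
      case False
      then have pos: "0 < mdist X x y" using xyz by (simp add: less_le)
      then have yz: "y \<noteq> z" using le xyz by auto
      have "x \<noteq> z"
      proof
        assume "x = z"
        then have "mdist X x y \<le> t * mdist X x y" using le by (simp add: mdist_commute)
        then show False using pos t by (simp add: mult_le_cancel_right1)
      qed
      with \<eta>[rule_format, OF xyz t(1) False yz] le
      have "mdist Y (f x) (f y) \<le> \<eta> t * mdist Y (f y) (f z)" by simp
      also have "\<dots> \<le> \<epsilon> * mdist Y (f y) (f z)" by (intro mult_right_mono \<eta>t) simp
      finally show ?thesis .
    qed
  qed (use t in auto)
qed

lemma quasisymmetric_map_bound:
  assumes "quasisymmetric_map X Y f" and "0 < t"
  shows "\<exists>B>0. \<forall>x\<in>mspace X. \<forall>y\<in>mspace X. \<forall>z\<in>mspace X.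
    mdist X x y \<le> t * mdist X y z \<longrightarrow> mdist Y (f x) (f y) \<le> B * mdist Y (f y) (f z)"
proof -
  from assms(1) obtain \<eta> \<eta>' where "homeomorphism {0::real..} {0..} \<eta> \<eta>'"
    and \<eta>: "\<forall>x\<in>mspace X. \<forall>y\<in>mspace X. \<forall>z\<in>mspace X. \<forall>t>0.
           x \<noteq> y \<longrightarrow> y \<noteq> z \<longrightarrow> x \<noteq> z \<longrightarrow> mdist X x y \<le> t * mdist X y z \<longrightarrow>
           mdist Y (f x) (f y) \<le> \<eta> t * mdist Y (f y) (f z)"
    and f: "f \<in> mspace X \<rightarrow> mspace Y" "inj_on f (mspace X)"
    by (rule quasisymmetric_mapE)
  \<comment> \<open>The 1 is for \<open>x = z\<close>, where the ratio in the target equals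
    1.\<close>
  define B where "B = max 1 (\<eta> t)"
  show ?thesis
  proof (intro exI[of _ B] conjI ballI impI)
    fix x y z assume xyz: "x \<in> mspace X" "y \<in> mspace X" "z \<in> mspace X"
      and le: "mdist X x y \<le> t * mdist X y z"
    consider "x = y" | "x = z" | "x \<noteq> y" "x \<noteq> z" by blast
    then show "mdist Y (f x) (f y) \<le> B * mdist Y (f y) (f z)"
    proof cases
      case 1
      then have "mdist Y (f x) (f y) = 0" using f xyz by (auto simp: Pi_iff)
      then show ?thesis by (simp add: B_def)
    next
      case 2
      then show ?thesis
        using mult_right_mono[of 1 B "mdist Y (f x) (f y)"] by (simp add: B_def mdist_commute)
    next
      case 3
      then have "0 < mdist X x y" using xyz by (simp add: less_le)
      then have "y \<noteq> z" using le xyz by auto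
      then have "mdist Y (f x) (f y) \<le> \<eta> t * mdist Y (f y) (f z)"
        using \<eta>[rule_format, OF xyz \<open>0 < t\<close> 3(1) _ 3(2)] le by simp
      also have "\<dots> \<le> B * mdist Y (f y) (f z)" by (intro mult_right_mono) (auto simp: B_def)
      finally show ?thesis .
    qed
  qed (auto simp: B_def)
qed

lemma quasisymmetric_map_id: "quasisymmetric_map X X id"
proof -
  have "homeomorphism {0::real..} {0..} id id" by (simp add: homeomorphism_ident id_def)
  then show ?thesis unfolding quasisymmetric_map_def by (auto intro!: exI[of _ id])
qed

text \<open>Words grow at the front: the children of the node \<open>w\<close> are the lists \<open>k # w\<close>, so that
  a word is an ancestor of its extensions when it is a suffix of them.\<close>

lemma subadditive_le_sum_over_cut:
  fixes G :: "'k list \<Rightarrow> real"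
  assumes "finite S" "finite A" and nonneg: "\<And>w. w \<in> S \<Longrightarrow> 0 \<le> G w"
    and sub: "\<And>w. w \<in> lists A \<Longrightarrow> m \<le> length w \<Longrightarrow> G w \<le> (\<Sum>k\<in>A. G (k # w))"
    and cut: "\<And>v. v \<in> lists A \<Longrightarrow> length v = n \<Longrightarrow> \<exists>w\<in>S. suffix w v"
    and "v \<in> lists A" "m \<le> length v" "length v \<le> n"
    and "\<And>w. w \<in> S \<Longrightarrow> \<not> strict_suffix w v"
  shows "G v \<le> (\<Sum>w | w \<in> S \<and> suffix v w. G w)"
  using assms(6-)
\<comment> \<open>A node outside \<open>S\<close> is expanded into its children, at level
  \<open>n\<close> at the latest the expansion has stopped: there some suffix lies in
  \<open>S\<close>, and since no strict suffix does, it is the word itself.\<close>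
proof (induction "n - length v" arbitrary: v)
  case 0
  then have "v \<in> S" using cut[of v] by (auto simp: strict_suffix_def)
  then show ?case
    using \<open>finite S\<close> nonneg by (intro member_le_sum) auto
next
  case (Suc j)
  show ?case
  proof (cases "v \<in> S")
    case True
    then show ?thesis using \<open>finite S\<close> nonneg by (intro member_le_sum) auto
  next
    case False
    have "G v \<le> (\<Sum>k\<in>A. G (k # v))" using sub Suc.prems by auto
    also have "\<dots> \<le> (\<Sum>k\<in>A. \<Sum>w | w \<in> S \<and> suffix (k # v) w. G w)"
    proof (intro sum_mono Suc.hyps(1))
      fix k w assume "w \<in> S"
      then show "\<not> strict_suffix w (k # v)"
        using False Suc.prems(4)[of w] by (auto simp: strict_suffix_def suffix_Cons)
    qed (use Suc in auto)
    \<comment> \<open>The subtrees below distinct children are disjoint, so no word of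
      \<open>S\<close> is counted twice.\<close>
    also have "\<dots> = (\<Sum>w\<in>(\<Union>k\<in>A. {w \<in> S. suffix (k # v) w}). G w)"
    proof (rule sum.UNION_disjoint[symmetric])
      have "i = k" if "suffix (i # v) w" "suffix (k # v) w" for i k w
        using suffix_length_suffix[OF that] by (auto simp: suffix_Cons dest: suffix_length_le)
      then show "\<forall>i\<in>A. \<forall>k\<in>A. i \<noteq> k \<longrightarrow> {w \<in> S. suffix (i # v) w} \<inter> {w \<in> S. suffix (k # v) w} = {}"
        by blast
    qed (use assms in auto)
    also have "\<dots> \<le> (\<Sum>w | w \<in> S \<and> suffix v w. G w)"
      using \<open>finite S\<close> nonneg
      by (intro sum_mono2) (auto dest: suffix_ConsD)
    finally show ?thesis .
  qed
qed

section \<open>Cylinders over the unit interval\<close>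

definition words :: "nat \<Rightarrow> nat list set" where
  "words N = lists {..<N}"

lemma words_simps [simp]:
  "[] \<in> words N"
  "k # w \<in> words N \<longleftrightarrow> k < N \<and> w \<in> words N"
  "u @ w \<in> words N \<longleftrightarrow> u \<in> words N \<and> w \<in> words N"
  "rev w \<in> words N \<longleftrightarrow> w \<in> words N"
  by (auto simp: words_def)

lemma finite_words_length: "finite {w. w \<in> words N \<and> length w = n}"
  using finite_lists_length_eq[of "{..<N}" n]
  by (rule rev_finite_subset) (auto simp: words_def)

lemma words_length_Suc:
  "{w. w \<in> words N \<and> length w = Suc n} = (\<Union>w\<in>{w. w \<in> words N \<and> length w = n}. (\<lambda>k. k # w) ` {..<N})"
  by (auto simp: length_Suc_conv)

text \<open>\<open>C w\<close> stands for the cylinder \<open>\<phi>\<^sub>w(K)\<close>, \<open>p\<close> for the first coordinate, and \<open>lo w\<close>, \<open>W w\<close> for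
  the left endpoint and the length of \<open>p (C w)\<close>. Condition \<open>C_fiber\<close> is what remains of the
  coordinate ordering: cylinders get thin relative to their width.\<close>

locale cylinder_tree =
  fixes X :: "'a metric" and N :: nat and C :: "nat list \<Rightarrow> 'a set" and p :: "'a \<Rightarrow> real"
    and lo W :: "nat list \<Rightarrow> real" and \<Delta> \<theta> \<sigma> \<tau> :: real
  assumes compact: "compactin (mtopology_of X) (mspace X)"
    and C_Nil: "C [] = mspace X"
    and C_children: "\<And>w. w \<in> words N \<Longrightarrow> C w = (\<Union>k<N. C (k # w))"
    and p_C: "\<And>w. w \<in> words N \<Longrightarrow> p ` C w = {lo w..lo w + W w}"
    and W_Nil: "0 < W []"
    and W_lower: "\<And>w k. w \<in> words N \<Longrightarrow> k < N \<Longrightarrow> \<sigma> * W w \<le> W (k # w)"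
    and W_upper: "\<And>w k. w \<in> words N \<Longrightarrow> k < N \<Longrightarrow> W (k # w) \<le> \<tau> * W w"
    and \<sigma>: "0 < \<sigma>" and \<tau>: "0 < \<tau>" "\<tau> < 1" and \<theta>: "0 < \<theta>" "\<theta> < 1"
    and p_lipschitz: "\<And>x y. x \<in> mspace X \<Longrightarrow> y \<in> mspace X \<Longrightarrow> \<bar>p x - p y\<bar> \<le> mdist X x y"
    and C_diam: "\<And>w x y. w \<in> words N \<Longrightarrow> x \<in> C w \<Longrightarrow> y \<in> C w \<Longrightarrow> mdist X x y \<le> \<Delta> * W w"
    and C_fiber: "\<And>w x y. w \<in> words N \<Longrightarrow> x \<in> C w \<Longrightarrow> y \<in> C w \<Longrightarrow> p x = p y \<Longrightarrow>
      mdist X x y \<le> \<Delta> * \<theta> ^ length w * W w"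
    and disjoint: "\<And>w j k. w \<in> words N \<Longrightarrow> j < N \<Longrightarrow> k < N \<Longrightarrow> j \<noteq> k \<Longrightarrow>
      {lo (j # w)<..<lo (j # w) + W (j # w)} \<inter> {lo (k # w)<..<lo (k # w) + W (k # w)} = {}"
begin

lemma W_pos: "w \<in> words N \<Longrightarrow> 0 < W w"
proof (induction w)
  case Nil
  show ?case by (rule W_Nil)
next
  case (Cons k w)
  then have "0 < \<sigma> * W w" using \<sigma> by simp
  also have "\<dots> \<le> W (k # w)" using W_lower Cons by simp
  finally show ?case .
qed

lemma W_append_le: "u \<in> words N \<Longrightarrow> w \<in> words N \<Longrightarrow> W (u @ w) \<le> \<tau> ^ length u * W w"
proof (induction u)
  case (Cons k u)
  have "W (k # u @ w) \<le> \<tau> * W (u @ w)" using Cons.prems by (intro W_upper) auto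
  also have "\<dots> \<le> \<tau> * (\<tau> ^ length u * W w)" using Cons \<tau> by (intro mult_left_mono) auto
  finally show ?case by simp
qed simp

lemma C_append_subset: "u \<in> words N \<Longrightarrow> w \<in> words N \<Longrightarrow> C (u @ w) \<subseteq> C w"
proof (induction u)
  case (Cons k u)
  then have "C (k # u @ w) \<subseteq> C (u @ w)" by (subst (2) C_children) auto
  then show ?case using Cons by auto
qed simp

lemma C_subset: "w \<in> words N \<Longrightarrow> C w \<subseteq> mspace X"
  using C_append_subset[of w "[]"] by (simp add: C_Nil)

lemma C_nonempty: "w \<in> words N \<Longrightarrow> C w \<noteq> {}"
  using p_C[of w] W_pos[of w] by auto

lemma N_pos: "0 < N"
  using C_children[of "[]"] C_nonempty[of "[]"] by (cases N) auto

lemma exists_point: "w \<in> words N \<Longrightarrow> t \<in> {lo w..lo w + W w} \<Longrightarrow> \<exists>x\<in>C w. p x = t"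
  using p_C[of w] by (metis imageE)

lemma C_p_range: "w \<in> words N \<Longrightarrow> x \<in> C w \<Longrightarrow> lo w \<le> p x \<and> p x \<le> lo w + W w"
  using p_C[of w] by auto

lemma exists_far_point:
  assumes w: "w \<in> words N" and x: "x \<in> C w"
  shows "\<exists>z\<in>C w. W w \<le> 2 * mdist X x z"
proof -
  have xX: "x \<in> mspace X" using C_subset w x by auto
  define t where "t = (if p x \<le> lo w + W w / 2 then lo w + W w else lo w)"
  have "t \<in> {lo w..lo w + W w}" using W_pos[OF w] by (simp add: t_def)
  then obtain z where z: "z \<in> C w" "p z = t" using exists_point[OF w] by blast
  have "W w / 2 \<le> \<bar>p x - p z\<bar>" using z(2) W_pos[OF w] by (cases "p x \<le> lo w + W w / 2") (simp_all add: t_def)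
  also have "\<dots> \<le> mdist X x z" using z C_subset w xX by (intro p_lipschitz) auto
  finally show ?thesis using z(1) by (intro bexI[of _ z]) auto
qed

lemma \<Delta>_ge_1: "1 \<le> \<Delta>"
proof -
  have w: "[] \<in> words N" by simp
  obtain x where x: "x \<in> C []" "p x = lo []" using exists_point[OF w, of "lo []"] W_Nil by auto
  obtain y where y: "y \<in> C []" "p y = lo [] + W []" using exists_point[OF w, of "lo [] + W []"] W_Nil by auto
  have "W [] = \<bar>p x - p y\<bar>" using x y W_Nil by simp
  also have "\<dots> \<le> mdist X x y" using x y by (intro p_lipschitz) (auto simp: C_Nil)
  also have "\<dots> \<le> \<Delta> * W []" using x y by (intro C_diam) auto
  finally show ?thesis using W_Nil by simp
qed

lemma interval_append_subset:
  assumes "u \<in> words N" "w \<in> words N"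
  shows "lo w \<le> lo (u @ w)" "lo (u @ w) + W (u @ w) \<le> lo w + W w"
proof -
  have "p ` C (u @ w) \<subseteq> p ` C w" using C_append_subset[OF assms] by auto
  then have "{lo (u @ w)..lo (u @ w) + W (u @ w)} \<subseteq> {lo w..lo w + W w}"
    using assms by (simp add: p_C)
  then show "lo w \<le> lo (u @ w)" "lo (u @ w) + W (u @ w) \<le> lo w + W w"
    using W_pos[of "u @ w"] assms by auto
qed

text \<open>Read from the root, that is reversed, the two words part at some letter. The two
  siblings there have disjoint open intervals, and these contain the intervals of the words.\<close>

lemma disjoint_parallel:
  assumes "v \<in> words N" "w \<in> words N" "\<not> suffix v w" "\<not> suffix w v"
  shows "{lo v<..<lo v + W v} \<inter> {lo w<..<lo w + W w} = {}"
proof -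
  have "rev v \<parallel> rev w" using assms by (simp add: parallel_def suffix_to_prefix)
  then obtain as b bs c cs where "b \<noteq> c" "rev v = as @ b # bs" "rev w = as @ c # cs"
    by (auto dest: parallel_decomp)
  then have vw: "v = rev bs @ b # rev as" "w = rev cs @ c # rev as"
    by (metis append.assoc append_Cons append_Nil rev.simps(2) rev_append rev_rev_ident)+
  have "{lo (b # rev as)<..<lo (b # rev as) + W (b # rev as)} \<inter>
      {lo (c # rev as)<..<lo (c # rev as) + W (c # rev as)} = {}"
    using assms \<open>b \<noteq> c\<close> unfolding vw by (intro disjoint) auto
  moreover have "lo (b # rev as) \<le> lo v" "lo v + W v \<le> lo (b # rev as) + W (b # rev as)"
    using assms interval_append_subset[of "rev bs" "b # rev as"] unfolding vw by auto
  moreover have "lo (c # rev as) \<le> lo w" "lo w + W w \<le> lo (c # rev as) + W (c # rev as)"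
    using assms interval_append_subset[of "rev cs" "c # rev as"] unfolding vw by auto
  ultimately show ?thesis by fastforce
qed

section \<open>Counting cylinders by the lengths of their intervals\<close>

lemma sum_W_le:
  assumes "finite F" "F \<subseteq> words N" "a \<le> b"
    and par: "\<And>v w. v \<in> F \<Longrightarrow> w \<in> F \<Longrightarrow> v \<noteq> w \<Longrightarrow> \<not> suffix v w"
    and "\<And>w. w \<in> F \<Longrightarrow> a \<le> lo w \<and> lo w + W w \<le> b"
  shows "(\<Sum>w\<in>F. W w) \<le> b - a"
proof -
  have "(\<Sum>w\<in>F. W w) = (\<Sum>w\<in>F. (lo w + W w) - lo w)" by simp
  also have "\<dots> \<le> b - a"
  proof (rule sum_length_disjoint_intervals_le)
    show "disjoint_family_on (\<lambda>w. {lo w<..<lo w + W w}) F"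
      unfolding disjoint_family_on_def
      using par assms(2) by (intro ballI impI disjoint_parallel) auto
    fix w assume "w \<in> F"
    then show "a \<le> lo w \<and> lo w \<le> lo w + W w \<and> lo w + W w \<le> b"
      using assms(5)[of w] W_pos[of w] assms(2) by force
  qed (use assms in auto)
  finally show ?thesis .
qed

lemma sum_W_level_le: "(\<Sum>w | w \<in> words N \<and> length w = n. W w) \<le> W []"
proof -
  have "lo [] \<le> lo w \<and> lo w + W w \<le> lo [] + W []" if "w \<in> words N" for w
    using interval_append_subset[of w "[]"] that by simp
  moreover have "\<not> suffix v w" if "v \<noteq> w" "length v = length w" for v w :: "nat list"
    using that by (auto simp: suffix_def)
  ultimately have "(\<Sum>w | w \<in> words N \<and> length w = n. W w) \<le> (lo [] + W []) - lo []"
    using W_Nil by (intro sum_W_le finite_words_length) auto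
  then show ?thesis by simp
qed

lemma C_level: "mspace X = (\<Union>w\<in>{w. w \<in> words N \<and> length w = n}. C w)"
proof (induction n)
  case 0
  have "{w. w \<in> words N \<and> length w = 0} = {[]}" by auto
  then show ?case by (simp add: C_Nil)
next
  case (Suc n)
  have "(\<Union>w\<in>{w. w \<in> words N \<and> length w = Suc n}. C w) =
      (\<Union>w\<in>{w. w \<in> words N \<and> length w = n}. \<Union>k<N. C (k # w))"
    by (simp add: words_length_Suc)
  also have "\<dots> = (\<Union>w\<in>{w. w \<in> words N \<and> length w = n}. C w)"
    using C_children by auto
  finally show ?case using Suc by simp
qed

text \<open>A Moran cut: on each branch the first word of width at most \<open>r\<close>, kept if
  its cylinder meets \<open>A\<close>. Words grow at the front, so \<open>tl w\<close> is the
  parent; the root has no parent and qualifies as soon as \<open>W [] \<le> r\<close>.\<close>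

definition moran :: "real \<Rightarrow> 'a set \<Rightarrow> nat list set" where
  "moran r A = {w \<in> words N. C w \<inter> A \<noteq> {} \<and> W w \<le> r \<and> (w \<noteq> [] \<longrightarrow> r < W (tl w))}"

text \<open>The parent of a proper extension of \<open>v\<close> has width at most
  \<open>W v \<le> r\<close>, so the extension is no first word of width at most
  \<open>r\<close>.\<close>

lemma moran_parallel:
  assumes "v \<in> moran r A" "w \<in> moran r A" "v \<noteq> w"
  shows "\<not> suffix v w"
proof
  assume "suffix v w"
  with assms(3) obtain k u where w: "w = k # u @ v"
    by (metis append_Cons append_Nil neq_Nil_conv suffix_def)
  have in_lists: "u \<in> words N" "v \<in> words N" using assms(1,2) by (auto simp: moran_def w)
  have "W (u @ v) \<le> \<tau> ^ length u * W v" by (rule W_append_le[OF in_lists])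
  also have "\<dots> \<le> W v"
    using \<tau> W_pos[OF in_lists(2)] by (simp add: mult_le_cancel_right1 power_le_one)
  also have "\<dots> \<le> r" using assms(1) by (simp add: moran_def)
  finally show False using assms(2) by (simp add: moran_def w)
qed

lemma moran_W_lower:
  assumes "w \<in> moran r A" "r \<le> W []" "\<sigma> \<le> 1"
  shows "\<sigma> * r \<le> W w"
proof (cases w)
  case Nil
  have "\<sigma> * r \<le> \<sigma> * W []" using assms \<sigma> by (intro mult_left_mono) auto
  also have "\<dots> \<le> 1 * W []" using assms W_Nil by (intro mult_right_mono) auto
  finally show ?thesis using Nil by simp
next
  case (Cons k u)
  then have "\<sigma> * r \<le> \<sigma> * W u" using assms \<sigma> by (intro mult_left_mono) (auto simp: moran_def)
  also have "\<dots> \<le> W w" using assms Cons W_lower by (auto simp: moran_def)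
  finally show ?thesis .
qed

lemma \<sigma>_le_1: "\<sigma> \<le> 1"
proof -
  have "\<sigma> * W [] \<le> \<tau> * W []" using W_lower[of "[]" 0] W_upper[of "[]" 0] N_pos by simp
  then show ?thesis using W_Nil \<tau> by simp
qed

text \<open>A length count on the line: the open intervals are disjoint, have length at least
  \<open>\<sigma> * r\<close> and lie within \<open>(B + 1) * r\<close> of \<open>c\<close>.
  Counting in finite subfamilies yields finiteness as well.\<close>

lemma finite_moran:
  assumes r: "0 < r" "r \<le> W []" and A: "\<And>x. x \<in> A \<Longrightarrow> \<bar>p x - c\<bar> \<le> B * r" and "0 \<le> B"
  shows "finite (moran r A) \<and> card (moran r A) \<le> nat \<lceil>(2 * B + 2) / \<sigma>\<rceil>"
proof (rule finite_if_finite_subsets_card_bdd)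
  fix F assume F: "F \<subseteq> moran r A" "finite F"
  have "real (card F) * (\<sigma> * r) = (\<Sum>w\<in>F. \<sigma> * r)" by simp
  also have "\<dots> \<le> (\<Sum>w\<in>F. W w)"
    using F r \<sigma>_le_1 by (intro sum_mono moran_W_lower) auto
  also have "\<dots> \<le> (c + (B + 1) * r) - (c - (B + 1) * r)"
  proof (rule sum_W_le)
    show "\<not> suffix v w" if "v \<in> F" "w \<in> F" "v \<noteq> w" for v w
      using moran_parallel F that by blast
    have "0 \<le> (B + 1) * r" using \<open>0 \<le> B\<close> r by simp
    then show "c - (B + 1) * r \<le> c + (B + 1) * r" by simp
    fix w assume "w \<in> F"
    then have w: "w \<in> words N" "C w \<inter> A \<noteq> {}" "W w \<le> r"
      using F by (auto simp: moran_def)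
    then obtain x where x: "x \<in> C w" "x \<in> A" by auto
    show "c - (B + 1) * r \<le> lo w \<and> lo w + W w \<le> c + (B + 1) * r"
      using C_p_range[OF w(1) x(1)] A[OF x(2)] w(3) by (simp add: algebra_simps abs_le_iff)
  qed (use F in \<open>auto simp: moran_def\<close>)
  finally have "r * (real (card F) * \<sigma>) \<le> r * (2 * B + 2)" by (simp add: algebra_simps)
  then have "real (card F) * \<sigma> \<le> 2 * B + 2" using r by simp
  then have "real (card F) \<le> (2 * B + 2) / \<sigma>" using \<sigma> by (simp add: pos_le_divide_eq)
  then show "card F \<le> nat \<lceil>(2 * B + 2) / \<sigma>\<rceil>" by linarith
qed

text \<open>Letters are dropped from \<open>v\<close> as long as the parent still has width at most
  \<open>r\<close>; the cylinders only grow and thus keep meeting \<open>A\<close>. Consequently the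
  stopping words of a cover of the space form a cut of the tree.\<close>

lemma moran_suffix:
  assumes "v \<in> words N" "W v \<le> r" "C v \<inter> A \<noteq> {}"
  shows "\<exists>w\<in>moran r A. suffix w v"
  using assms
proof (induction v)
  case Nil
  then show ?case by (auto simp: moran_def)
next
  case (Cons k v)
  show ?case
  proof (cases "r < W v")
    case True
    then show ?thesis using Cons.prems by (intro bexI[of _ "k # v"]) (auto simp: moran_def)
  next
    case False
    have "C (k # v) \<subseteq> C v" using C_append_subset[of "[k]" v] Cons.prems by auto
    then show ?thesis using Cons False by (auto simp: suffix_Cons)
  qed
qed

end

section \<open>Diameters of image cylinders\<close>

locale quasisymmetric_tree = cylinder_tree X N C p lo W \<Delta> \<theta> \<sigma> \<tau>
  for X :: "'a metric" and N C p lo W \<Delta> \<theta> \<sigma> \<tau> +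
  fixes Y :: "'b metric" and f :: "'a \<Rightarrow> 'b"
  assumes qs: "quasisymmetric_map X Y f"
begin

abbreviation e :: "'a \<Rightarrow> 'a \<Rightarrow> real" where
  "e x y \<equiv> mdist Y (f x) (f y)"

lemma f_in: "x \<in> mspace X \<Longrightarrow> f x \<in> mspace Y"
  using qs by (auto simp: quasisymmetric_map_def)

lemma f_inj: "x \<in> mspace X \<Longrightarrow> y \<in> mspace X \<Longrightarrow> f x = f y \<Longrightarrow> x = y"
  using qs by (auto simp: quasisymmetric_map_def dest: inj_onD)

lemma e_triangle: "x \<in> mspace X \<Longrightarrow> y \<in> mspace X \<Longrightarrow> z \<in> mspace X \<Longrightarrow> e x z \<le> e x y + e y z"
  by (intro mdist_triangle f_in)

lemma C_in: "w \<in> words N \<Longrightarrow> x \<in> C w \<Longrightarrow> x \<in> mspace X"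
  using C_subset by blast

text \<open>With \<open>y\<close> and \<open>z\<close> far apart in the root cylinder, every
  \<open>x\<close> satisfies \<open>mdist X x y \<le> 2 * \<Delta> * mdist X y z\<close>, so
  quasisymmetry bounds \<open>e x y\<close> by a multiple of \<open>e y z\<close>. This makes the
  suprema \<open>D w\<close> finite.\<close>

lemma e_bounded: "\<exists>B. \<forall>x\<in>mspace X. \<forall>y\<in>mspace X. e x y \<le> B"
proof -
  obtain y where y: "y \<in> C []" using C_nonempty[of "[]"] by auto
  then obtain z where z: "z \<in> C []" "W [] \<le> 2 * mdist X y z"
    using exists_far_point[of "[]" y] by auto
  have yz: "y \<in> mspace X" "z \<in> mspace X" using y z by (auto simp: C_Nil)
  obtain B where B: "\<forall>x\<in>mspace X. \<forall>y\<in>mspace X. \<forall>z\<in>mspace X.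
      mdist X x y \<le> (2 * \<Delta>) * mdist X y z \<longrightarrow> e x y \<le> B * e y z"
    using quasisymmetric_map_bound[OF qs, of "2 * \<Delta>"] \<Delta>_ge_1 by auto
  have le: "e x y \<le> B * e y z" if "x \<in> mspace X" for x
  proof -
    have "mdist X x y \<le> \<Delta> * W []" using that y by (intro C_diam) (auto simp: C_Nil)
    also have "\<dots> \<le> \<Delta> * (2 * mdist X y z)" using z \<Delta>_ge_1 by (intro mult_left_mono) auto
    finally show ?thesis using B that yz by simp
  qed
  have "e x x' \<le> B * e y z + B * e y z" if "x \<in> mspace X" "x' \<in> mspace X" for x x'
    using e_triangle[OF that(1) yz(1) that(2)] le[OF that(1)] le[OF that(2)]
    by (simp add: mdist_commute)
  then show ?thesis by blast
qed

definition D :: "nat list \<Rightarrow> real" where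
  "D w = (SUP z\<in>C w \<times> C w. e (fst z) (snd z))"

lemma D_upper: "w \<in> words N \<Longrightarrow> x \<in> C w \<Longrightarrow> y \<in> C w \<Longrightarrow> e x y \<le> D w"
proof -
  assume w: "w \<in> words N" and xy: "x \<in> C w" "y \<in> C w"
  obtain B where "\<forall>x\<in>mspace X. \<forall>y\<in>mspace X. e x y \<le> B" using e_bounded by blast
  then have "bdd_above ((\<lambda>z. e (fst z) (snd z)) ` (C w \<times> C w))"
    using C_in[OF w] by (intro bdd_aboveI[of _ B]) auto
  from cSUP_upper[OF _ this, of "(x, y)"] xy show ?thesis by (simp add: D_def)
qed

lemma D_least: "w \<in> words N \<Longrightarrow> (\<And>x y. x \<in> C w \<Longrightarrow> y \<in> C w \<Longrightarrow> e x y \<le> c) \<Longrightarrow> D w \<le> c"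
  unfolding D_def using C_nonempty[of w] by (intro cSUP_least) auto

lemma D_pos: "w \<in> words N \<Longrightarrow> 0 < D w"
proof -
  assume w: "w \<in> words N"
  then obtain x where x: "x \<in> C w" using C_nonempty by blast
  obtain z where z: "z \<in> C w" "W w \<le> 2 * mdist X x z" using exists_far_point[OF w x] by blast
  have X: "x \<in> mspace X" "z \<in> mspace X" using C_in w x z by auto
  have "x \<noteq> z" using z(2) W_pos[OF w] X by auto
  then have "e x z \<noteq> 0" using X f_in f_inj by auto
  then have "0 < e x z" by (simp add: less_le)
  also have "\<dots> \<le> D w" by (rule D_upper[OF w x z(1)])
  finally show ?thesis .
qed

lemma D_append_le: "u \<in> words N \<Longrightarrow> w \<in> words N \<Longrightarrow> D (u @ w) \<le> D w"
  using C_append_subset[of u w] by (intro D_least D_upper) auto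

text \<open>Walking from left to right, each interval used is discarded; so the children need not be
  sorted, and passing from one child to the next costs at most \<open>2 * g\<close>.\<close>

lemma e_le_sum_cover:
  fixes g :: real
  assumes w: "w \<in> words N" and F: "finite F" "F \<subseteq> {..<N}"
    and gap: "\<And>x y. x \<in> C w \<Longrightarrow> y \<in> C w \<Longrightarrow> p x = p y \<Longrightarrow> e x y \<le> g"
    and "x \<in> C w" "y \<in> C w" "p x \<le> p y"
    and "{p x..p y} \<subseteq> (\<Union>k\<in>F. {lo (k # w)..lo (k # w) + W (k # w)})"
  shows "e x y \<le> (\<Sum>k\<in>F. D (k # w)) + 2 * card F * g"
  using assms(2,3,5-)
proof (induction "card F" arbitrary: F x)
  case 0
  then show ?case by auto
next
  case (Suc n)
  have "p x \<in> {p x..p y}" using Suc.prems by simp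
  with Suc.prems obtain k where k: "k \<in> F" "p x \<in> {lo (k # w)..lo (k # w) + W (k # w)}" by blast
  have kw: "k # w \<in> words N" using k Suc.prems w by auto
  have sub: "C (k # w) \<subseteq> C w" using C_append_subset[of "[k]" w] kw by simp
  have inX: "z \<in> mspace X" if "z \<in> C w" for z using C_in w that by blast
  have g: "0 \<le> g" using gap[of x x] Suc.prems(3) by (meson mdist_nonneg order_trans)
  \<comment> \<open>The point \<open>x\<close> may belong to another child; moving within its fiber
    to a point of child \<open>k\<close> costs at most \<open>g\<close>.\<close>
  obtain x' where x': "x' \<in> C (k # w)" "p x' = p x" using exists_point[OF kw k(2)] by blast
  have exx': "e x x' \<le> g" using gap[of x x'] Suc.prems x' sub by auto
  have sum: "(\<Sum>k\<in>F. D (k # w)) = D (k # w) + (\<Sum>k\<in>F - {k}. D (k # w))"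
    using sum.remove[OF Suc.prems(1) k(1)] by simp
  have nonneg: "0 \<le> (\<Sum>k\<in>F - {k}. D (k # w))"
    using Suc.prems w by (intro sum_nonneg less_imp_le D_pos) auto
  show ?case
  proof (cases "p y \<le> lo (k # w) + W (k # w)")
    case True
    then have "p y \<in> {lo (k # w)..lo (k # w) + W (k # w)}" using k Suc.prems by auto
    then obtain y' where y': "y' \<in> C (k # w)" "p y' = p y" using exists_point[OF kw] by blast
    have "e y' y \<le> g" using gap[of y' y] Suc.prems y' sub by auto
    moreover have "e x' y' \<le> D (k # w)" using D_upper[OF kw] x' y' by auto
    moreover have "e x y \<le> e x x' + e x' y" "e x' y \<le> e x' y' + e y' y"
      using Suc.prems x' y' sub inX by (auto intro!: e_triangle)
    moreover have "2 * g \<le> 2 * card F * g"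
      using g Suc.hyps(2) mult_right_mono[of 1 "real (card F)" g] by simp
    ultimately show ?thesis using exx' sum nonneg by linarith
  next
    case False
    define R where "R = lo (k # w) + W (k # w)"
    have "R \<in> {lo (k # w)..lo (k # w) + W (k # w)}" using W_pos[OF kw] by (simp add: R_def)
    then obtain y' where y': "y' \<in> C (k # w)" "p y' = R" using exists_point[OF kw] by blast
    \<comment> \<open>To the right of \<open>R\<close> the interval of \<open>k\<close> contributes
      nothing. The remaining finite union of closed intervals also contains the limit point
      \<open>R\<close>, so it covers all of \<open>[R, p y]\<close>.\<close>
    have "{R<..p y} \<subseteq> (\<Union>j\<in>F - {k}. {lo (j # w)..lo (j # w) + W (j # w)})"
    proof
      fix t assume t: "t \<in> {R<..p y}"
      then have "t \<in> {p x..p y}" using k by (auto simp: R_def)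
      then obtain j where j: "j \<in> F" "t \<in> {lo (j # w)..lo (j # w) + W (j # w)}"
        using Suc.prems(6) by blast
      with t have "j \<noteq> k" by (auto simp: R_def)
      with j show "t \<in> (\<Union>j\<in>F - {k}. {lo (j # w)..lo (j # w) + W (j # w)})"
        by blast
    qed
    moreover have "closed (\<Union>j\<in>F - {k}. {lo (j # w)..lo (j # w) + W (j # w)})"
      using Suc.prems(1) by (intro closed_UN) simp_all
    ultimately have "closure {R<..p y} \<subseteq> (\<Union>j\<in>F - {k}. {lo (j # w)..lo (j # w) + W (j # w)})"
      by (rule closure_minimal)
    moreover have "closure {R<..p y} = {R..p y}"
      using False by (intro closure_greaterThanAtMost) (simp add: R_def)
    ultimately have cov: "{p y'..p y} \<subseteq> (\<Union>j\<in>F - {k}. {lo (j # w)..lo (j # w) + W (j # w)})"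
      using y' by simp
    have card: "card F = Suc (card (F - {k}))" using card.remove[OF Suc.prems(1) k(1)] by simp
    have "e y' y \<le> (\<Sum>j\<in>F - {k}. D (j # w)) + 2 * card (F - {k}) * g"
    proof (rule Suc.hyps(1))
      show "n = card (F - {k})" using card Suc.hyps(2) by simp
      show "p y' \<le> p y" using y' False by (simp add: R_def)
    qed (use Suc.prems cov y' sub in auto)
    moreover have "e x' y' \<le> D (k # w)" using D_upper[OF kw] x' y' by auto
    moreover have "e x y \<le> e x x' + e x' y" "e x' y \<le> e x' y' + e y' y"
      using Suc.prems x' y' sub inX by (auto intro!: e_triangle)
    moreover have "2 * card F * g = 2 * card (F - {k}) * g + 2 * g"
      using card by (simp add: algebra_simps)
    ultimately show ?thesis using exx' sum g by linarith
  qed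
qed

section \<open>Subadditivity and decay of the image diameters\<close>

lemma D_le_sum_children:
  fixes g :: real
  assumes w: "w \<in> words N"
    and gap: "\<And>x y. x \<in> C w \<Longrightarrow> y \<in> C w \<Longrightarrow> p x = p y \<Longrightarrow> e x y \<le> g"
  shows "D w \<le> (\<Sum>k<N. D (k # w)) + 2 * N * g"
proof (rule D_least[OF w])
  have le: "e x y \<le> (\<Sum>k<N. D (k # w)) + 2 * N * g" if "x \<in> C w" "y \<in> C w" "p x \<le> p y" for x y
  proof -
    have "{p x..p y} \<subseteq> {lo w..lo w + W w}" using C_p_range[OF w] that by fastforce
    also have "\<dots> = p ` (\<Union>k<N. C (k # w))" using p_C[OF w] C_children[OF w] by simp
    also have "\<dots> = (\<Union>k\<in>{..<N}. {lo (k # w)..lo (k # w) + W (k # w)})"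
      using w by (simp add: image_UN p_C)
    finally show ?thesis
      using e_le_sum_cover[OF w, of "{..<N}" g x y] gap that by simp
  qed
  fix x y assume "x \<in> C w" "y \<in> C w"
  then show "e x y \<le> (\<Sum>k<N. D (k # w)) + 2 * N * g"
    using le[of x y] le[of y x] by (cases "p x \<le> p y") (auto simp: mdist_commute)
qed

text \<open>Two points of one fiber are at distance at most
  \<open>\<Delta> * \<theta> ^ length w * W w\<close>, whereas some point of the cylinder is at
  least \<open>W w / 2\<close> away. The ratio tends to 0 as the level grows, hence so does the
  ratio of the image distances.\<close>

lemma gap_small:
  assumes "0 < \<epsilon>"
  shows "\<exists>n. \<forall>w\<in>words N. n \<le> length w \<longrightarrow>
    (\<forall>x\<in>C w. \<forall>y\<in>C w. p x = p y \<longrightarrow> e x y \<le> \<epsilon> * D w)"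
proof -
  obtain t where t: "0 < t" "\<forall>x\<in>mspace X. \<forall>y\<in>mspace X. \<forall>z\<in>mspace X.
      mdist X x y \<le> t * mdist X y z \<longrightarrow> e x y \<le> \<epsilon> * e y z"
    using quasisymmetric_map_small[OF qs assms] by blast
  obtain n where n: "\<theta> ^ n < t / (2 * \<Delta>)"
    using real_arch_pow_inv[of "t / (2 * \<Delta>)" \<theta>] t \<Delta>_ge_1 \<theta> by auto
  show ?thesis
  proof (intro exI[of _ n] ballI impI)
    fix w x y assume w: "w \<in> words N" and len: "n \<le> length w"
      and xy: "x \<in> C w" "y \<in> C w" "p x = p y"
    obtain z where z: "z \<in> C w" "W w \<le> 2 * mdist X y z" using exists_far_point w xy by blast
    have "\<theta> ^ length w \<le> \<theta> ^ n" using \<theta> len by (intro power_decreasing) auto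
    then have "\<Delta> * \<theta> ^ length w \<le> \<Delta> * \<theta> ^ n" using \<Delta>_ge_1 by (intro mult_left_mono) auto
    also have "\<dots> \<le> t / 2" using n \<Delta>_ge_1 by (simp add: field_simps)
    finally have th: "\<Delta> * \<theta> ^ length w \<le> t / 2" .
    have "mdist X x y \<le> \<Delta> * \<theta> ^ length w * W w" using C_fiber w xy by blast
    also have "\<dots> \<le> t / 2 * (2 * mdist X y z)"
      using th z t W_pos[OF w] by (intro mult_mono) auto
    finally have "e x y \<le> \<epsilon> * e y z" using t C_in[OF w] xy z by simp
    also have "\<dots> \<le> \<epsilon> * D w" using assms D_upper[OF w] xy z by (intro mult_left_mono) auto
    finally show "e x y \<le> \<epsilon> * D w" .
  qed
qed

text \<open>The same comparison as for fibers: a descendant \<open>m\<close> levels down has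
  diameter at most \<open>\<Delta> * \<tau> ^ m * W w\<close>, to be set against a point at distance
  at least \<open>W w / 2\<close>.\<close>

lemma D_halving: "\<exists>m>0. \<forall>u\<in>words N. \<forall>w\<in>words N. length u = m \<longrightarrow> D (u @ w) \<le> D w / 2"
proof -
  obtain t where t: "0 < t" "\<forall>x\<in>mspace X. \<forall>y\<in>mspace X. \<forall>z\<in>mspace X.
      mdist X x y \<le> t * mdist X y z \<longrightarrow> e x y \<le> (1 / 2) * e y z"
    using quasisymmetric_map_small[OF qs, of "1 / 2"] by auto
  obtain n where n: "\<tau> ^ n < t / (2 * \<Delta>)"
    using real_arch_pow_inv[of "t / (2 * \<Delta>)" \<tau>] t \<Delta>_ge_1 \<tau> by auto
  show ?thesis
  \<comment> \<open>The successor keeps the number of levels positive, as the root taken in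
    \<open>D_decay\<close> requires.\<close>
  proof (intro exI[of _ "Suc n"] conjI ballI impI)
    fix u w assume uw: "u \<in> words N" "w \<in> words N" "length u = Suc n"
    have "\<tau> ^ length u \<le> \<tau> ^ n" using \<tau> uw(3) by (intro power_decreasing) auto
    then have "\<Delta> * \<tau> ^ length u \<le> \<Delta> * \<tau> ^ n" using \<Delta>_ge_1 by (intro mult_left_mono) auto
    also have "\<dots> \<le> t / 2" using n \<Delta>_ge_1 by (simp add: field_simps)
    finally have th: "\<Delta> * \<tau> ^ length u \<le> t / 2" .
    show "D (u @ w) \<le> D w / 2"
    proof (rule D_least)
      fix x y assume xy: "x \<in> C (u @ w)" "y \<in> C (u @ w)"
      have xy': "x \<in> C w" "y \<in> C w" using xy C_append_subset uw by blast+
      obtain z where z: "z \<in> C w" "W w \<le> 2 * mdist X y z" using exists_far_point uw xy' by blast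
      have "mdist X x y \<le> \<Delta> * W (u @ w)" using uw xy by (intro C_diam) auto
      also have "\<dots> \<le> \<Delta> * (\<tau> ^ length u * W w)"
        using uw \<Delta>_ge_1 by (intro mult_left_mono W_append_le) auto
      also have "\<dots> = \<Delta> * \<tau> ^ length u * W w" by simp
      also have "\<dots> \<le> t / 2 * (2 * mdist X y z)"
        using th z t W_pos[OF uw(2)] by (intro mult_mono) auto
      finally have "e x y \<le> (1 / 2) * e y z" using t C_in[OF uw(2)] xy' z by simp
      also have "\<dots> \<le> D w / 2" using D_upper[OF uw(2)] xy' z by simp
      finally show "e x y \<le> D w / 2" .
    qed (use uw in simp)
  qed simp
qed

lemma D_decay: "\<exists>\<rho> B. 0 < \<rho> \<and> \<rho> < 1 \<and> 0 < B \<and> (\<forall>w\<in>words N. D w \<le> B * \<rho> ^ length w)"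
proof -
  obtain m where m: "0 < m"
    "\<forall>u\<in>words N. \<forall>w\<in>words N. length u = m \<longrightarrow> D (u @ w) \<le> D w / 2"
    using D_halving by blast
  \<comment> \<open>With this rate \<open>m\<close> levels cost exactly the factor 1/2; the factor 2
    in \<open>2 * D []\<close> pays for the words shorter than \<open>m\<close>.\<close>
  define \<rho> where "\<rho> = root m (1 / 2)"
  have \<rho>: "0 < \<rho>" "\<rho> < 1" "\<rho> ^ m = 1 / 2" using m(1) by (simp_all add: \<rho>_def)
  have B: "0 < 2 * D []" using D_pos[of "[]"] by simp
  have "D w \<le> 2 * D [] * \<rho> ^ length w" if "w \<in> words N" for w
    using that
  proof (induction "length w" arbitrary: w rule: less_induct)
    case less
    show ?case
    proof (cases "length w < m")
      case True
      have "D w \<le> D []" using D_append_le[of w "[]"] less.prems by simp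
      also have "\<dots> = 2 * D [] * \<rho> ^ m" using \<rho> by simp
      also have "\<dots> \<le> 2 * D [] * \<rho> ^ length w"
        using \<rho> B True by (intro mult_left_mono power_decreasing) auto
      finally show ?thesis .
    next
      case False
      have td: "take m w \<in> words N" "drop m w \<in> words N"
        using less.prems words_simps(3)[of "take m w" "drop m w" N] by simp_all
      have "D w \<le> D (drop m w) / 2"
        using m(2) td False by (metis append_take_drop_id length_take min.absorb2 not_less)
      also have "\<dots> \<le> (2 * D [] * \<rho> ^ length (drop m w)) / 2"
        using less.hyps[of "drop m w"] td False m(1) by (intro divide_right_mono) auto
      also have "\<dots> = 2 * D [] * (\<rho> ^ length (drop m w) * \<rho> ^ m)" using \<rho> by simp
      also have "\<dots> = 2 * D [] * \<rho> ^ length w" using False by (simp flip: power_add)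
      finally show ?thesis .
    qed
  qed
  then show ?thesis using \<rho> B by blast
qed

lemma D_le_mult_sum_children:
  assumes "1 < \<kappa>"
  shows "\<exists>n. \<forall>w\<in>words N. n \<le> length w \<longrightarrow> D w \<le> \<kappa> * (\<Sum>k<N. D (k # w))"
proof -
  \<comment> \<open>This turns the error \<open>2 * N * (\<epsilon> * D w)\<close> into
    \<open>(1 - 1 / \<kappa>) * D w\<close>, which the left side absorbs.\<close>
  define \<epsilon> where "\<epsilon> = (1 - 1 / \<kappa>) / (2 * N)"
  have "0 < \<epsilon>" using assms N_pos by (simp add: \<epsilon>_def)
  then obtain n where n: "\<forall>w\<in>words N. n \<le> length w \<longrightarrow>
      (\<forall>x\<in>C w. \<forall>y\<in>C w. p x = p y \<longrightarrow> e x y \<le> \<epsilon> * D w)"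
    using gap_small by blast
  show ?thesis
  proof (intro exI[of _ n] ballI impI)
    fix w assume w: "w \<in> words N" "n \<le> length w"
    have "D w \<le> (\<Sum>k<N. D (k # w)) + 2 * N * (\<epsilon> * D w)"
      using n w by (intro D_le_sum_children) auto
    also have "2 * N * (\<epsilon> * D w) = (1 - 1 / \<kappa>) * D w" using N_pos by (simp add: \<epsilon>_def)
    finally have "D w / \<kappa> \<le> (\<Sum>k<N. D (k # w))" by (simp add: algebra_simps)
    then show "D w \<le> \<kappa> * (\<Sum>k<N. D (k # w))" using assms by (simp add: field_simps)
  qed
qed

end

section \<open>Coverings by cylinders\<close>

lemma sum_UN_le:
  fixes g :: "'i \<Rightarrow> real"
  assumes "finite I" "\<And>i. i \<in> I \<Longrightarrow> finite (S i)" "\<And>i w. i \<in> I \<Longrightarrow> w \<in> S i \<Longrightarrow> 0 \<le> g w"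
  shows "(\<Sum>w\<in>(\<Union>i\<in>I. S i). g w) \<le> (\<Sum>i\<in>I. \<Sum>w\<in>S i. g w)"
  using assms
proof (induction I rule: finite_induct)
  case (insert j I)
  have "(\<Sum>w\<in>S j \<union> (\<Union>i\<in>I. S i). g w) \<le> (\<Sum>w\<in>S j. g w) + (\<Sum>w\<in>(\<Union>i\<in>I. S i). g w)"
  proof -
    have "0 \<le> (\<Sum>w\<in>S j \<inter> (\<Union>i\<in>I. S i). g w)"
      using insert.prems by (intro sum_nonneg) auto
    moreover have "(\<Sum>w\<in>S j \<union> (\<Union>i\<in>I. S i). g w) =
        (\<Sum>w\<in>S j. g w) + (\<Sum>w\<in>(\<Union>i\<in>I. S i). g w) - (\<Sum>w\<in>S j \<inter> (\<Union>i\<in>I. S i). g w)"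
      using insert by (intro sum_Un) auto
    ultimately show ?thesis by linarith
  qed
  also have "(\<Sum>w\<in>(\<Union>i\<in>I. S i). g w) \<le> (\<Sum>i\<in>I. \<Sum>w\<in>S i. g w)"
    using insert.prems by (intro insert.IH) auto
  finally show ?case using insert.hyps by simp
qed simp

lemma powr_add_le:
  fixes a b s :: real
  assumes "0 \<le> a" "0 \<le> b" "0 < s"
  shows "(a + b) powr s \<le> 2 powr s * (a powr s + b powr s)"
proof -
  have "(a + b) powr s \<le> (2 * max a b) powr s" using assms by (intro powr_mono2) auto
  also have "\<dots> = 2 powr s * max a b powr s" using assms by (simp add: powr_mult)
  also have "max a b powr s \<le> a powr s + b powr s" by (auto simp: max_def)
  finally show ?thesis by simp
qed

lemma mdist_le_set_diameter:
  assumes "set_diameter m U \<le> ennreal \<delta>" "x \<in> U" "y \<in> U"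
  shows "mdist m x y \<le> enn2real (set_diameter m U)"
proof -
  have "ennreal (mdist m x y) \<le> set_diameter m U"
    unfolding set_diameter_def by (rule SUP_upper2[OF assms(2)], rule SUP_upper2[OF assms(3)]) simp
  moreover have "set_diameter m U < top" using assms(1) ennreal_less_top le_less_trans by blast
  ultimately have "enn2real (ennreal (mdist m x y)) \<le> enn2real (set_diameter m U)"
    by (intro enn2real_mono)
  then show ?thesis by simp
qed

text \<open>Vanishing measure is unpacked into a cover with real diameter bounds \<open>d i\<close>
  and bounds on finite sums, so that the later estimates stay within the reals.\<close>

lemma hausdorff_outer_0_cover:
  assumes "hausdorff_outer m s A = 0" "0 < \<delta>" "0 < c"
  obtains U :: "nat \<Rightarrow> 'a set" and d :: "nat \<Rightarrow> real" where "A \<subseteq> (\<Union>i. U i)" "\<forall>i. U i \<subseteq> mspace m"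
    "\<forall>i. 0 \<le> d i \<and> d i \<le> \<delta>" "\<forall>i. \<forall>x\<in>U i. \<forall>y\<in>U i. mdist m x y \<le> d i"
    "\<forall>I. finite I \<longrightarrow> (\<Sum>i\<in>I. d i powr s) \<le> c"
proof -
  have "hausdorff_premeasure m s \<delta> A \<le> hausdorff_outer m s A"
    unfolding hausdorff_outer_def using assms(2) by (intro SUP_upper) auto
  then have "hausdorff_premeasure m s \<delta> A < ennreal c" using assms by simp
  then obtain U :: "nat \<Rightarrow> 'a set" where U: "A \<subseteq> (\<Union>i. U i)"
      "\<forall>i. U i \<subseteq> mspace m \<and> set_diameter m (U i) \<le> ennreal \<delta>"
      "(\<Sum>i. ennreal (enn2real (set_diameter m (U i)) powr s)) < ennreal c"
    unfolding hausdorff_premeasure_def Inf_less_iff by auto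
  define d where "d i = enn2real (set_diameter m (U i))" for i
  show thesis
  proof (rule that[of U d])
    show "\<forall>i. 0 \<le> d i \<and> d i \<le> \<delta>"
    proof (intro allI conjI)
      show "d i \<le> \<delta>" for i
        using enn2real_mono[of "set_diameter m (U i)" "ennreal \<delta>"] U(2) assms(2) by (simp add: d_def)
    qed (simp add: d_def)
    show "\<forall>i. \<forall>x\<in>U i. \<forall>y\<in>U i. mdist m x y \<le> d i"
    proof (intro allI ballI)
      show "mdist m x y \<le> d i" if "x \<in> U i" "y \<in> U i" for i x y
        unfolding d_def using U(2) that by (intro mdist_le_set_diameter[where \<delta> = \<delta>]) simp_all
    qed
    show "\<forall>I. finite I \<longrightarrow> (\<Sum>i\<in>I. d i powr s) \<le> c"
    proof (intro allI impI)
      fix I :: "nat set" assume "finite I"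
      then have "(\<Sum>i\<in>I. ennreal (d i powr s)) \<le> (\<Sum>i. ennreal (d i powr s))"
        by (intro sum_le_suminf) auto
      also have "\<dots> \<le> ennreal c" using U(3) by (simp add: d_def less_imp_le)
      finally have "ennreal (\<Sum>i\<in>I. d i powr s) \<le> ennreal c" by (simp add: sum_ennreal)
      then show "(\<Sum>i\<in>I. d i powr s) \<le> c" using assms(3) by (simp add: ennreal_le_iff)
    qed
  qed (use U in blast)+
qed

section \<open>Small cylinders around a point\<close>

context cylinder_tree
begin

lemma mdist_le: "x \<in> mspace X \<Longrightarrow> y \<in> mspace X \<Longrightarrow> mdist X x y \<le> \<Delta> * W []"
  using C_diam[of "[]" x y] by (simp add: C_Nil)

lemma exists_level_W_less:
  assumes "0 < \<epsilon>"
  shows "\<exists>n\<ge>m. \<forall>w\<in>words N. length w = n \<longrightarrow> W w < \<epsilon>"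
proof -
  obtain n where n: "\<tau> ^ n < \<epsilon> / W []"
    using real_arch_pow_inv[of "\<epsilon> / W []" \<tau>] assms W_Nil \<tau> by auto
  have "W w < \<epsilon>" if "w \<in> words N" "length w = max m n" for w
  proof -
    have "W w \<le> \<tau> ^ length w * W []" using W_append_le[of w "[]"] that by simp
    also have "\<dots> \<le> \<tau> ^ n * W []"
      using \<tau> W_Nil that by (intro mult_right_mono power_decreasing) auto
    also have "\<dots> < \<epsilon>" using n W_Nil by (simp add: pos_less_divide_eq)
    finally show ?thesis .
  qed
  then show ?thesis by (intro exI[of _ "max m n"]) auto
qed

text \<open>A small cylinder through \<open>x\<close> contains a point at distance at least half its
  width from \<open>x\<close>.\<close>

lemma no_isolated_points:
  assumes x: "x \<in> mspace X" and "0 < \<epsilon>"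
  shows "\<exists>z\<in>mspace X. z \<noteq> x \<and> mdist X x z < \<epsilon>"
proof -
  have "0 < \<epsilon> / \<Delta>" using assms \<Delta>_ge_1 by simp
  then obtain n where n: "\<forall>w\<in>words N. length w = n \<longrightarrow> W w < \<epsilon> / \<Delta>"
    using exists_level_W_less by blast
  have "x \<in> (\<Union>w\<in>{w. w \<in> words N \<and> length w = n}. C w)" using x C_level[of n] by simp
  then obtain w where w: "w \<in> words N" "length w = n" "x \<in> C w" by blast
  obtain z where z: "z \<in> C w" "W w \<le> 2 * mdist X x z" using exists_far_point[OF w(1,3)] by blast
  have "mdist X x z \<le> \<Delta> * W w" using C_diam w z by blast
  also have "\<dots> < \<epsilon>" using n w \<Delta>_ge_1 by (simp add: pos_less_divide_eq mult.commute)
  finally have "mdist X x z < \<epsilon>" .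
  moreover have "z \<noteq> x" using z(2) W_pos[OF w(1)] x by auto
  ultimately show ?thesis using z(1) C_subset[OF w(1)] by blast
qed

end

section \<open>Covering a set by few comparable image cylinders\<close>

context quasisymmetric_tree
begin

text \<open>The tree is cut at a width proportional to the size of \<open>A\<close>. The cylinders
  of the cut stay near \<open>A\<close>, so by quasisymmetry their images are not much larger than
  the image of \<open>A\<close>. Neither \<open>M\<close> nor \<open>L\<close> depends on
  \<open>A\<close>, which is what the covering argument rests on.\<close>

lemma moran_cover:
  "\<exists>M L. 0 \<le> L \<and> (\<forall>A a. A \<subseteq> mspace X \<longrightarrow> (\<exists>x\<in>A. \<exists>y\<in>A. x \<noteq> y) \<longrightarrow> (\<forall>x\<in>A. \<forall>y\<in>A. e x y \<le> a) \<longrightarrow>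
    (\<exists>r>0. finite (moran r A) \<and> card (moran r A) \<le> M \<and> (\<forall>w\<in>moran r A. D w \<le> L * a)))"
proof -
  \<comment> \<open>The factor 3 is 1 for crossing a cylinder of the cut plus 2 for going from there
    to \<open>y\<close> within \<open>A\<close>.\<close>
  obtain B where B: "0 < B" "\<forall>x\<in>mspace X. \<forall>y\<in>mspace X. \<forall>z\<in>mspace X.
      mdist X x y \<le> 3 * mdist X y z \<longrightarrow> e x y \<le> B * e y z"
    using quasisymmetric_map_bound[OF qs, of 3] by auto
  define M where "M = nat \<lceil>(2 * (2 * \<Delta>) + 2) / \<sigma>\<rceil>"
  have "\<exists>r>0. finite (moran r A) \<and> card (moran r A) \<le> M \<and> (\<forall>w\<in>moran r A. D w \<le> 2 * B * a)"
    if A: "A \<subseteq> mspace X" "\<exists>x\<in>A. \<exists>y\<in>A. x \<noteq> y" "\<forall>x\<in>A. \<forall>y\<in>A. e x y \<le> a" for A a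
  proof -
    from A obtain y z0 where y: "y \<in> A" "z0 \<in> A" "y \<noteq> z0" by blast
    have yX: "y \<in> mspace X" using y A by blast
    \<comment> \<open>The radius of \<open>A\<close> about \<open>y\<close> may not be attained; a
      \<open>z\<close> beyond half of it is enough.\<close>
    define R where "R = (SUP x\<in>A. mdist X y x)"
    have bdd: "bdd_above ((\<lambda>x. mdist X y x) ` A)"
      using A(1) yX mdist_le by (intro bdd_aboveI[of _ "\<Delta> * W []"]) blast
    have R: "mdist X y x \<le> R" if "x \<in> A" for x
      unfolding R_def using that bdd by (intro cSUP_upper) auto
    have "z0 \<in> mspace X" using y A by blast
    with yX y(3) have "0 < mdist X y z0" by (simp add: less_le)
    with R[OF y(2)] have "R / 2 < R" by simp
    moreover have "\<exists>z\<in>A. c < mdist X y z" if "c < R" for c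
      using that less_cSUP_iff[OF _ bdd] y(1) unfolding R_def by blast
    ultimately obtain z where z: "z \<in> A" "R / 2 < mdist X y z" by blast
    have le2: "mdist X y x \<le> 2 * mdist X y z" if "x \<in> A" for x using R[OF that] z by linarith
    have zX: "z \<in> mspace X" using z A by blast
    \<comment> \<open>Cylinders of width at most \<open>r\<close> then have diameter at most
      \<open>mdist X y z\<close>, and \<open>r \<le> W []\<close> holds.\<close>
    define r where "r = mdist X y z / \<Delta>"
    have pos: "0 < mdist X y z" using z R[OF y(2)] \<open>0 < mdist X y z0\<close> by linarith
    have r: "0 < r" "r \<le> W []"
      using pos \<Delta>_ge_1 mdist_le[OF yX zX] by (simp_all add: r_def pos_divide_le_eq mult.commute)
    have "finite (moran r A) \<and> card (moran r A) \<le> nat \<lceil>(2 * (2 * \<Delta>) + 2) / \<sigma>\<rceil>"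
    proof (rule finite_moran[OF r])
      fix x assume "x \<in> A"
      then have "\<bar>p x - p y\<bar> \<le> 2 * mdist X y z"
        using p_lipschitz[of x y] le2[of x] A yX by (auto simp: mdist_commute)
      then show "\<bar>p x - p y\<bar> \<le> (2 * \<Delta>) * r" using \<Delta>_ge_1 by (simp add: r_def)
    qed (use \<Delta>_ge_1 in simp)
    moreover have "D w \<le> 2 * B * a" if mw: "w \<in> moran r A" for w
    proof (rule D_least)
      show w: "w \<in> words N" using mw by (simp add: moran_def)
      obtain x0 where x0: "x0 \<in> C w" "x0 \<in> A" using mw by (auto simp: moran_def)
      have x0X: "x0 \<in> mspace X" using x0 A by blast
      have le: "e x y \<le> B * a" if x: "x \<in> C w" for x
      proof -
        have xX: "x \<in> mspace X" using C_in[OF w x] .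
        have "mdist X x x0 \<le> \<Delta> * W w" using C_diam w x x0 by blast
        also have "\<dots> \<le> \<Delta> * r" using mw \<Delta>_ge_1 by (intro mult_left_mono) (auto simp: moran_def)
        also have "\<dots> = mdist X y z" using \<Delta>_ge_1 by (simp add: r_def)
        finally have "mdist X x x0 \<le> mdist X y z" .
        moreover have "mdist X x y \<le> mdist X x x0 + mdist X x0 y"
          using xX x0X yX by (rule mdist_triangle)
        moreover have "mdist X x0 y \<le> 2 * mdist X y z" using le2[OF x0(2)] by (simp add: mdist_commute)
        ultimately have "mdist X x y \<le> 3 * mdist X y z" by linarith
        then have "e x y \<le> B * e y z" using B xX yX zX by blast
        also have "\<dots> \<le> B * a" using A(3) y z B by (intro mult_left_mono) auto
        finally show ?thesis .
      qed
      fix x x' assume xx': "x \<in> C w" "x' \<in> C w"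
      have "e x x' \<le> e x y + e y x'" using C_in[OF w] xx' yX by (intro e_triangle) auto
      then show "e x x' \<le> 2 * B * a"
        using le[OF xx'(1)] le[OF xx'(2)] by (simp add: mdist_commute)
    qed
    ultimately show ?thesis using r(1) unfolding M_def by blast
  qed
  moreover have "0 \<le> 2 * B" using B by simp
  ultimately show ?thesis by blast
qed

text \<open>Compared with a fixed second point \<open>z\<close>, a point \<open>y\<close> very close
  to \<open>x\<close> has \<open>e y x\<close> at most a small multiple of the constant
  \<open>e x z\<close>.\<close>

lemma continuous_at:
  assumes x: "x \<in> mspace X" and "0 < \<epsilon>"
  shows "\<exists>t>0. \<forall>y\<in>mspace X. mdist X x y < t \<longrightarrow> e x y < \<epsilon>"
proof -
  obtain z where z: "z \<in> mspace X" "z \<noteq> x" using no_isolated_points[OF x, of 1] by auto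
  have "e x z \<noteq> 0" using f_in f_inj x z by auto
  then have exz: "0 < e x z" by (simp add: less_le)
  define \<epsilon>' where "\<epsilon>' = \<epsilon> / (2 * e x z)"
  have "0 < \<epsilon>'" using exz assms by (simp add: \<epsilon>'_def)
  from quasisymmetric_map_small[OF qs this]
  obtain t where t: "0 < t" "\<forall>x\<in>mspace X. \<forall>y\<in>mspace X. \<forall>z\<in>mspace X.
      mdist X x y \<le> t * mdist X y z \<longrightarrow> e x y \<le> \<epsilon>' * e y z" by blast
  have "0 < mdist X x z" using x z by (simp add: less_le)
  show ?thesis
  proof (intro exI[of _ "t * mdist X x z"] conjI ballI impI)
    fix y assume y: "y \<in> mspace X" "mdist X x y < t * mdist X x z"
    then have "mdist X y x \<le> t * mdist X x z" by (simp add: mdist_commute)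
    then have "e y x \<le> \<epsilon>' * e x z" using t(2) x y z by blast
    also have "\<dots> = \<epsilon> / 2" using exz by (simp add: \<epsilon>'_def)
    finally show "e x y < \<epsilon>" using assms by (simp add: mdist_commute)
  qed (use t \<open>0 < mdist X x z\<close> in auto)
qed

end

section \<open>Hausdorff dimension of quasisymmetric images\<close>

context quasisymmetric_tree
begin

text \<open>With \<open>\<rho>\<close> the decay rate of \<open>D\<close>, the factor \<open>\<kappa> = \<rho> powr (s - 1)\<close> compensates the loss at each
  node, and \<open>\<kappa> ^ length w\<close> is still bounded by a multiple of \<open>D w powr (s - 1)\<close>.\<close>

lemma weight_bound:
  assumes "0 < s" "s < 1"
  shows "\<exists>\<kappa> m Q. 1 < \<kappa> \<and> 0 < Q \<and>
    (\<forall>w\<in>words N. m \<le> length w \<longrightarrow>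
      D w * \<kappa> ^ length w \<le> (\<Sum>k<N. D (k # w) * \<kappa> ^ length (k # w))) \<and>
    (\<forall>w\<in>words N. D w * \<kappa> ^ length w \<le> Q * D w powr s)"
proof -
  obtain \<rho> B where \<rho>: "0 < \<rho>" "\<rho> < 1" "0 < B" "\<forall>w\<in>words N. D w \<le> B * \<rho> ^ length w"
    using D_decay by blast
  define \<kappa> where "\<kappa> = \<rho> powr (s - 1)"
  have \<kappa>: "1 < \<kappa>" using \<rho> assms by (simp add: \<kappa>_def powr_def mult_neg_neg)
  obtain m where m: "\<forall>w\<in>words N. m \<le> length w \<longrightarrow> D w \<le> \<kappa> * (\<Sum>k<N. D (k # w))"
    using D_le_mult_sum_children[OF \<kappa>] by blast
  have "D w * \<kappa> ^ length w \<le> (\<Sum>k<N. D (k # w) * \<kappa> ^ length (k # w))"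
    if "w \<in> words N" "m \<le> length w" for w
  proof -
    have "D w * \<kappa> ^ length w \<le> (\<kappa> * (\<Sum>k<N. D (k # w))) * \<kappa> ^ length w"
      using m that \<kappa> by (intro mult_right_mono) auto
    also have "\<dots> = (\<Sum>k<N. D (k # w) * \<kappa> ^ length (k # w))"
      by (simp add: sum_distrib_left sum_distrib_right mult_ac)
    finally show ?thesis .
  qed
  moreover have "D w * \<kappa> ^ length w \<le> B powr (1 - s) * D w powr s" if w: "w \<in> words N" for w
  proof -
    have pos: "0 < D w" by (rule D_pos[OF w])
    \<comment> \<open>The decay estimate is applied to the first factor only; the resulting
      \<open>(\<rho> powr (1 - s)) ^ length w\<close> cancels
      \<open>\<kappa> ^ length w\<close>.\<close>
    have "D w = D w powr (1 - s) * D w powr s" using pos by (simp flip: powr_add)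
    also have "\<dots> \<le> (B * \<rho> ^ length w) powr (1 - s) * D w powr s"
      using \<rho> w pos assms by (intro mult_right_mono powr_mono2) auto
    also have "(B * \<rho> ^ length w) powr (1 - s) = B powr (1 - s) * (\<rho> powr (1 - s)) ^ length w"
    proof -
      have "(\<rho> ^ length w) powr (1 - s) = (\<rho> powr (1 - s)) ^ length w"
        using \<rho> by (simp add: powr_powr mult.commute flip: powr_realpow)
      then show ?thesis using \<rho> by (simp add: powr_mult)
    qed
    finally have "D w * \<kappa> ^ length w \<le>
        B powr (1 - s) * (\<rho> powr (1 - s)) ^ length w * D w powr s * \<kappa> ^ length w"
      using \<kappa> by (intro mult_right_mono) auto
    also have "\<dots> = B powr (1 - s) * D w powr s * (\<rho> powr (1 - s) * \<kappa>) ^ length w"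
      by (simp add: power_mult_distrib mult_ac)
    also have "\<rho> powr (1 - s) * \<kappa> = 1" using \<rho> by (simp add: \<kappa>_def flip: powr_add)
    finally show ?thesis by simp
  qed
  moreover have "0 < B powr (1 - s)" using \<rho> by simp
  ultimately show ?thesis using \<kappa> by blast
qed

text \<open>There are finitely many short words. Hence a small image diameter forces a word to be so
  long that subadditivity is available.\<close>

lemma D_lower_short: "\<exists>\<delta>>0. \<forall>w\<in>words N. length w < m \<longrightarrow> \<delta> < D w"
proof -
  define F where "F = insert 1 (D ` (\<Union>n<m. {w. w \<in> words N \<and> length w = n}))"
  have "finite F" "F \<noteq> {}" by (simp_all add: F_def finite_words_length)
  moreover have "\<forall>x\<in>F. 0 < x" using D_pos by (auto simp: F_def)
  ultimately have pos: "0 < Min F" by simp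
  show ?thesis
  proof (intro exI[of _ "Min F / 2"] conjI ballI impI)
    fix w assume "w \<in> words N" "length w < m"
    then have "D w \<in> F" by (auto simp: F_def)
    with \<open>finite F\<close> have "Min F \<le> D w" by simp
    with pos show "Min F / 2 < D w" by simp
  qed (use pos in simp)
qed

text \<open>If the measure vanished, a cover of the image with small sum would pull back to a finite
  cut of the tree of total weight below \<open>G v\<close> for a node \<open>v\<close> of level
  \<open>m\<close>, against subadditivity below \<open>v\<close>.\<close>

lemma hausdorff_outer_image_pos:
  assumes s: "0 < s" "s < 1"
  shows "hausdorff_outer Y s (f ` mspace X) \<noteq> 0"
proof
  assume zero: "hausdorff_outer Y s (f ` mspace X) = 0"
  obtain \<kappa> m Q where \<kappa>: "1 < \<kappa>" "0 < Q"
    and sub: "\<forall>w\<in>words N. m \<le> length w \<longrightarrow>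
      D w * \<kappa> ^ length w \<le> (\<Sum>k<N. D (k # w) * \<kappa> ^ length (k # w))"
    and up: "\<forall>w\<in>words N. D w * \<kappa> ^ length w \<le> Q * D w powr s"
    using weight_bound[OF s] by blast
  define G where "G w = D w * \<kappa> ^ length w" for w
  obtain \<delta>1 where \<delta>1: "0 < \<delta>1" "\<forall>w\<in>words N. length w < m \<longrightarrow> \<delta>1 < D w"
    using D_lower_short by blast
  obtain M L where L: "0 \<le> L" and cover: "\<forall>A a. A \<subseteq> mspace X \<longrightarrow> (\<exists>x\<in>A. \<exists>y\<in>A. x \<noteq> y) \<longrightarrow>
      (\<forall>x\<in>A. \<forall>y\<in>A. e x y \<le> a) \<longrightarrow>
      (\<exists>r>0. finite (moran r A) \<and> card (moran r A) \<le> M \<and> (\<forall>w\<in>moran r A. D w \<le> L * a))"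
    using moran_cover by (elim exE conjE)
  define v where "v = replicate m (0::nat)"
  have v: "v \<in> words N" "length v = m" using N_pos by (auto simp: v_def words_def)
  have G_nonneg: "0 \<le> G w" if "w \<in> words N" for w
    using D_pos[OF that] \<kappa> by (simp add: G_def)
  have Gv: "0 < G v" using D_pos[OF v(1)] \<kappa> by (simp add: G_def)
  \<comment> \<open>Adding 1 keeps \<open>P\<close> positive even if \<open>M\<close> or
    \<open>L\<close> is 0, so that \<open>c\<close> can be defined by division.\<close>
  define P where "P = M * (Q * L powr s) + 1"
  have P: "0 < P" using \<kappa> by (simp add: P_def add_nonneg_pos)
  \<comment> \<open>The final bound \<open>P * 2 powr s * (c + c)\<close> becomes
    \<open>G v / 2\<close>.\<close>
  define c where "c = G v / (4 * P * 2 powr s)"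
  \<comment> \<open>Then \<open>L * (2 * \<delta>) \<le> \<delta>1\<close>, which excludes words
    shorter than \<open>m\<close> from the cut.\<close>
  define \<delta> where "\<delta> = \<delta>1 / (2 * (L + 1))"
  have c: "0 < c" using Gv P by (simp add: c_def)
  have \<delta>: "0 < \<delta>" using \<delta>1 L by (simp add: \<delta>_def)
  obtain U :: "nat \<Rightarrow> 'b set" and d where U: "f ` mspace X \<subseteq> (\<Union>i. U i)" "\<forall>i. U i \<subseteq> mspace Y"
    and d: "\<forall>i. 0 \<le> d i \<and> d i \<le> \<delta>" "\<forall>i. \<forall>x\<in>U i. \<forall>y\<in>U i. mdist Y x y \<le> d i"
    and dsum: "\<forall>I. finite I \<longrightarrow> (\<Sum>i\<in>I. d i powr s) \<le> c"
    by (rule hausdorff_outer_0_cover[OF zero \<delta> c])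
  \<comment> \<open>The sets \<open>U i\<close> need not be open, and compactness calls for open
    sets. Enlarging \<open>U i\<close> by \<open>b i / 2\<close> repairs this, at a total cost of at
    most \<open>c\<close> in the sum of s-th powers.\<close>
  define b where "b i = min \<delta> ((c * (1 / 2) ^ Suc i) powr (1 / s))" for i :: nat
  have b: "0 < b i" "b i \<le> \<delta>" "b i powr s \<le> c * (1 / 2) ^ Suc i" for i
  proof -
    show "0 < b i" "b i \<le> \<delta>" using \<delta> c by (auto simp: b_def)
    have "b i powr s \<le> ((c * (1 / 2) ^ Suc i) powr (1 / s)) powr s"
      using s \<delta> c by (intro powr_mono2) (auto simp: b_def)
    also have "\<dots> = c * (1 / 2) ^ Suc i" using s c by (simp add: powr_powr)
    finally show "b i powr s \<le> c * (1 / 2) ^ Suc i" .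
  qed
  define A where "A i = {x \<in> mspace X. \<exists>u\<in>U i. mdist Y (f x) u < b i / 2}" for i
  have A_diam: "e x y \<le> d i + b i" if x: "x \<in> A i" and y: "y \<in> A i" for x y i
  proof -
    obtain u u' where u: "u \<in> U i" "mdist Y (f x) u < b i / 2" "u' \<in> U i" "mdist Y (f y) u' < b i / 2"
      using x y by (auto simp: A_def)
    have inY: "f x \<in> mspace Y" "f y \<in> mspace Y" "u \<in> mspace Y" "u' \<in> mspace Y"
      using x y u U(2) f_in unfolding A_def by blast+
    have "e x y \<le> mdist Y (f x) u + mdist Y u (f y)" using inY by (intro mdist_triangle)
    also have "mdist Y u (f y) \<le> mdist Y u u' + mdist Y u' (f y)" using inY by (intro mdist_triangle)
    finally show ?thesis using u d(2)[THEN spec, THEN bspec, THEN bspec, OF u(1,3)] by (simp add: mdist_commute)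
  qed
  have "\<exists>i t. 0 < t \<and> (\<forall>y\<in>mspace X. mdist X x y < t \<longrightarrow> y \<in> A i)" if x: "x \<in> mspace X" for x
  proof -
    obtain i where i: "f x \<in> U i" using U x by blast
    have "0 < b i / 2" using b by simp
    from continuous_at[OF x this]
    obtain t where t: "0 < t" "\<forall>y\<in>mspace X. mdist X x y < t \<longrightarrow> e x y < b i / 2" by blast
    have "y \<in> A i" if "y \<in> mspace X" "mdist X x y < t" for y
    proof -
      have "mdist Y (f y) (f x) < b i / 2" using t(2) that mdist_commute[of Y "f y" "f x"] by simp
      then show ?thesis using i that(1) unfolding A_def by blast
    qed
    then show ?thesis using t(1) by blast
  qed
  then obtain ii tt where it: "\<And>x. x \<in> mspace X \<Longrightarrow> 0 < tt x"
      "\<And>x y. x \<in> mspace X \<Longrightarrow> y \<in> mspace X \<Longrightarrow> mdist X x y < tt x \<Longrightarrow> y \<in> A (ii x)"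
    by metis
  have "\<exists>F\<subseteq>mspace X. finite F \<and> mspace X \<subseteq> (\<Union>x\<in>F. mball_of X x (tt x))"
  proof -
    have op: "openin (mtopology_of X) (mball_of X x (tt x))" for x
      by (simp add: mtopology_of_def mball_of_def Metric_space.openin_mball)
    have "mspace X \<subseteq> \<Union>((\<lambda>x. mball_of X x (tt x)) ` mspace X)" using it(1) by auto
    moreover have "\<forall>B \<in> (\<lambda>x. mball_of X x (tt x)) ` mspace X. openin (mtopology_of X) B"
      using op by blast
    ultimately obtain V where V: "finite V" "V \<subseteq> (\<lambda>x. mball_of X x (tt x)) ` mspace X" "mspace X \<subseteq> \<Union>V"
      using compact unfolding compactin_def by meson
    from finite_subset_image[OF V(1,2)]
    obtain F where "F \<subseteq> mspace X" "finite F" "V = (\<lambda>x. mball_of X x (tt x)) ` F" by blast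
    with V(3) show ?thesis by blast
  qed
  then obtain F where F: "F \<subseteq> mspace X" "finite F" "mspace X \<subseteq> (\<Union>x\<in>F. mball_of X x (tt x))" by blast
  define I where "I = ii ` F"
  have I: "finite I" using F by (simp add: I_def)
  have cov: "\<exists>i\<in>I. x \<in> A i" if x: "x \<in> mspace X" for x
  proof -
    obtain y where y: "y \<in> F" "x \<in> mball_of X y (tt y)" using F(3) x by blast
    then have "x \<in> A (ii y)" using it(2)[of y x] by simp
    then show ?thesis using y(1) by (auto simp: I_def)
  qed
  have "\<exists>r>0. finite (moran r (A i)) \<and> card (moran r (A i)) \<le> M \<and> (\<forall>w\<in>moran r (A i). D w \<le> L * (d i + b i))"
    if "i \<in> I" for i
  proof (rule cover[THEN spec, THEN spec, THEN mp, THEN mp, THEN mp])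
    obtain x where x: "x \<in> F" "i = ii x" using \<open>i \<in> I\<close> by (auto simp: I_def)
    have xX: "x \<in> mspace X" using x F by blast
    \<comment> \<open>\<open>U i\<close> may be a single point; the enlargement and the lack of
      isolated points provide the second point of \<open>A i\<close>.\<close>
    obtain z where "z \<in> mspace X" "z \<noteq> x" "mdist X x z < tt x"
      using no_isolated_points[OF xX it(1)[OF xX]] by blast
    then have "z \<in> A i" "x \<in> A i" using it[OF xX] xX x by auto
    then show "\<exists>x\<in>A i. \<exists>y\<in>A i. x \<noteq> y" using \<open>z \<noteq> x\<close> by blast
  qed (auto simp: A_def intro!: A_diam)
  then have "\<forall>i\<in>I. \<exists>r. 0 < r \<and> finite (moran r (A i)) \<and> card (moran r (A i)) \<le> M \<and>
      (\<forall>w\<in>moran r (A i). D w \<le> L * (d i + b i))" by blast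
  from bchoice[OF this] obtain r where r: "\<forall>i\<in>I. 0 < r i \<and> finite (moran (r i) (A i)) \<and>
      card (moran (r i) (A i)) \<le> M \<and> (\<forall>w\<in>moran (r i) (A i). D w \<le> L * (d i + b i))" by (elim exE)
  have r_pos: "0 < r i" and r_fin: "finite (moran (r i) (A i))" and r_card: "card (moran (r i) (A i)) \<le> M"
    if "i \<in> I" for i using r that by blast+
  have r_D: "D w \<le> L * (d i + b i)" if "i \<in> I" "w \<in> moran (r i) (A i)" for i w
    using r that by blast
  define S where "S = (\<Union>i\<in>I. moran (r i) (A i))"
  have S_words: "w \<in> words N" if "w \<in> S" for w using that unfolding S_def moran_def by blast
  have S_long: "m \<le> length w" if wS: "w \<in> S" for w
  proof (rule ccontr)
    assume "\<not> m \<le> length w"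
    then have "length w < m" by simp
    then have less: "\<delta>1 < D w" using \<delta>1(2) S_words[OF wS] by blast
    obtain i where i: "i \<in> I" "w \<in> moran (r i) (A i)" using wS unfolding S_def by blast
    have "D w \<le> L * (d i + b i)" using r_D[OF i] .
    also have "\<dots> \<le> L * (2 * \<delta>)" using L d(1)[THEN spec, of i] b(2)[of i] by (intro mult_left_mono) auto
    also have "\<dots> \<le> \<delta>1" using L \<delta>1 by (simp add: \<delta>_def field_simps)
    finally show False using less by simp
  qed
  \<comment> \<open>At a level where all widths are below the smallest stopping width
    \<open>r0\<close>, every word has a suffix in \<open>S\<close>; this makes \<open>S\<close> a
    cut.\<close>
  have "\<exists>r0>0. \<forall>i\<in>I. r0 \<le> r i"
    using I r_pos by (intro exI[of _ "Min (insert 1 (r ` I))"]) auto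
  then obtain r0 where r0: "0 < r0" "\<forall>i\<in>I. r0 \<le> r i" by blast
  obtain n where n: "m \<le> n" "\<forall>w\<in>words N. length w = n \<longrightarrow> W w < r0"
    using exists_level_W_less[OF r0(1)] by blast
  have "G v \<le> (\<Sum>w | w \<in> S \<and> suffix v w. G w)"
  proof (rule subadditive_le_sum_over_cut[where A = "{..<N}" and m = m and n = n])
    show "finite S" using I r_fin by (simp add: S_def)
    show "0 \<le> G w" if "w \<in> S" for w
      by (rule G_nonneg[OF S_words[OF that]])
    show "G w \<le> (\<Sum>k\<in>{..<N}. G (k # w))" if "w \<in> lists {..<N}" "m \<le> length w" for w
      using sub that unfolding G_def words_def by blast
    show "v \<in> lists {..<N}" using v by (simp add: words_def)
    show "\<not> strict_suffix w v" if "w \<in> S" for w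
      using S_long[OF that] v(2) by (auto dest: suffix_length_less)
    fix u assume "u \<in> lists {..<N}" "length u = n"
    then have u: "u \<in> words N" "W u < r0" using n by (auto simp: words_def)
    obtain x where x: "x \<in> C u" using C_nonempty[OF u(1)] by blast
    then obtain i where i: "i \<in> I" "x \<in> A i" using cov C_in[OF u(1)] by blast
    have "W u \<le> r i" using r0(2) i(1) u(2) by force
    then have "\<exists>w\<in>moran (r i) (A i). suffix w u" using x i u by (intro moran_suffix) auto
    then show "\<exists>w\<in>S. suffix w u" using i by (auto simp: S_def)
  qed (use n v in auto)
  also have "\<dots> \<le> (\<Sum>w\<in>S. G w)"
  proof (rule sum_mono2)
    show "finite S" using I r_fin by (simp add: S_def)
  qed (use G_nonneg S_words in blast)+
  also have "\<dots> \<le> (\<Sum>i\<in>I. \<Sum>w\<in>moran (r i) (A i). G w)"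
    unfolding S_def
  proof (rule sum_UN_le[OF I r_fin])
    show "0 \<le> G w" if "w \<in> moran (r i) (A i)" for i w
      using that by (intro G_nonneg) (simp add: moran_def)
  qed
  also have "\<dots> \<le> (\<Sum>i\<in>I. P * (d i + b i) powr s)"
  proof (rule sum_mono)
    fix i assume i: "i \<in> I"
    have db: "0 \<le> d i + b i" using d(1)[THEN spec, of i] b(1)[of i] by simp
    have "(\<Sum>w\<in>moran (r i) (A i). G w) \<le> (\<Sum>w\<in>moran (r i) (A i). Q * (L * (d i + b i)) powr s)"
    proof (rule sum_mono)
      fix w assume w: "w \<in> moran (r i) (A i)"
      then have ww: "w \<in> words N" by (simp add: moran_def)
      have "G w \<le> Q * D w powr s" using up ww by (simp add: G_def)
      also have "\<dots> \<le> Q * (L * (d i + b i)) powr s"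
        using r_D[OF i w] D_pos[OF ww] s \<kappa> by (intro mult_left_mono powr_mono2) auto
      finally show "G w \<le> Q * (L * (d i + b i)) powr s" .
    qed
    also have "\<dots> = card (moran (r i) (A i)) * (Q * L powr s) * (d i + b i) powr s"
      using L db by (simp add: powr_mult)
    also have "\<dots> \<le> M * (Q * L powr s) * (d i + b i) powr s"
      using r_card[OF i] \<kappa> by (intro mult_right_mono) auto
    also have "\<dots> \<le> P * (d i + b i) powr s" by (intro mult_right_mono) (auto simp: P_def)
    finally show "(\<Sum>w\<in>moran (r i) (A i). G w) \<le> P * (d i + b i) powr s" .
  qed
  also have "\<dots> = P * (\<Sum>i\<in>I. (d i + b i) powr s)" by (simp add: sum_distrib_left)
  also have "\<dots> \<le> P * (\<Sum>i\<in>I. 2 powr s * (d i powr s + b i powr s))"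
    using P d(1) b(1) s by (intro mult_left_mono sum_mono powr_add_le) (auto intro: less_imp_le)
  also have "\<dots> = P * 2 powr s * ((\<Sum>i\<in>I. d i powr s) + (\<Sum>i\<in>I. b i powr s))"
    by (simp add: sum.distrib flip: sum_distrib_left)
  also have "\<dots> \<le> P * 2 powr s * (c + c)"
  proof (intro mult_left_mono add_mono dsum[THEN spec, THEN mp] I)
    have "(\<Sum>i\<in>I. b i powr s) \<le> (\<Sum>i\<in>I. c * (1 / 2) ^ Suc i)" by (intro sum_mono b)
    also have "\<dots> = c * (\<Sum>i\<in>I. (1 / 2) ^ Suc i)" by (simp add: sum_distrib_left)
    also have "(\<Sum>i\<in>I. (1 / 2) ^ Suc i) \<le> (\<Sum>i. (1 / 2 :: real) ^ Suc i)"
      using I sums_summable[OF power_half_series] by (intro sum_le_suminf) auto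
    also have "\<dots> = 1" using power_half_series by (rule sums_unique[symmetric])
    finally show "(\<Sum>i\<in>I. b i powr s) \<le> c" using c by simp
  qed (use P in auto)
  also have "\<dots> = G v / 2" using P by (simp add: c_def)
  finally show False using Gv by simp
qed

lemma hausdorff_dim_image_ge_1: "1 \<le> hausdorff_dim Y (f ` mspace X)"
  unfolding hausdorff_dim_def
proof (intro Inf_greatest, clarify)
  fix s :: real assume "0 < s" "hausdorff_outer Y s (f ` mspace X) = 0"
  then have "1 \<le> s" using hausdorff_outer_image_pos[of s] by force
  then show "1 \<le> ennreal s" using ennreal_leI[of 1 s] by simp
qed

end

section \<open>The upper bound for the Hausdorff dimension\<close>

context cylinder_tree
begin

text \<open>The cylinders of one level cover the space, their widths add up to at most
  \<open>W []\<close>, and the surplus factor \<open>W w powr (s - 1)\<close> is uniformly small at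
  high levels.\<close>

lemma hausdorff_outer_0:
  assumes s: "1 < s"
  shows "hausdorff_outer X s (mspace X) = 0"
proof -
  have "hausdorff_premeasure X s \<delta> (mspace X) \<le> ennreal \<epsilon>" if "0 < \<delta>" "0 < \<epsilon>" for \<delta> \<epsilon>
  proof -
    \<comment> \<open>The solution of
      \<open>\<Delta> powr s * h powr (s - 1) * W [] = \<epsilon>\<close>.\<close>
    define h where "h = (\<epsilon> / (\<Delta> powr s * W [])) powr (1 / (s - 1))"
    have h: "0 < h" using that \<Delta>_ge_1 W_Nil by (simp add: h_def)
    have hs: "\<Delta> powr s * h powr (s - 1) * W [] = \<epsilon>"
      using that \<Delta>_ge_1 W_Nil s by (simp add: h_def powr_powr)
    have "0 < \<delta> / \<Delta>" using that(1) \<Delta>_ge_1 by simp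
    with h have "0 < min (\<delta> / \<Delta>) h" by simp
    then obtain n where n: "\<forall>w\<in>words N. length w = n \<longrightarrow> W w < min (\<delta> / \<Delta>) h"
      using exists_level_W_less by blast
    define E where "E = {w. w \<in> words N \<and> length w = n}"
    have fin: "finite E" by (simp add: E_def finite_words_length)
    obtain g where g: "bij_betw g {..<card E} E"
      using fin bij_betw_from_nat_into_finite lessThan_atLeast0 ex_bij_betw_nat_finite by metis
    \<comment> \<open>The finite cover is padded with empty sets, which contribute
      \<open>0 powr s = 0\<close>.\<close>
    define V where "V i = (if i < card E then C (g i) else {})" for i
    have gE: "g i \<in> E" if "i < card E" for i using g that by (auto simp: bij_betw_def)
    have diam: "set_diameter X (C w) \<le> ennreal (\<Delta> * W w)" if "w \<in> words N" for w
      unfolding set_diameter_def using C_diam that by (intro SUP_least ennreal_leI) auto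
    have empty: "set_diameter X {} = 0" by (simp add: set_diameter_def bot_ennreal)
    have "mspace X \<subseteq> (\<Union>i. V i)"
    proof
      fix x assume "x \<in> mspace X"
      then have "x \<in> (\<Union>w\<in>E. C w)" using C_level[of n] by (simp add: E_def)
      then obtain w where w: "w \<in> E" "x \<in> C w" by blast
      then obtain i where "i < card E" "w = g i" using g by (auto simp: bij_betw_def)
      then show "x \<in> (\<Union>i. V i)" using w by (intro UN_I[of i]) (auto simp: V_def)
    qed
    moreover have "V i \<subseteq> mspace X \<and> set_diameter X (V i) \<le> ennreal \<delta>" for i
    proof (cases "i < card E")
      case True
      then have w: "g i \<in> words N" "length (g i) = n" using gE by (auto simp: E_def)
      have "\<Delta> * W (g i) \<le> \<delta>" using n w \<Delta>_ge_1 by (simp add: pos_less_divide_eq mult.commute less_imp_le)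
      then have "set_diameter X (C (g i)) \<le> ennreal \<delta>"
        using diam[OF w(1)] by (meson ennreal_leI order_trans)
      then show ?thesis using True C_subset[OF w(1)] by (simp add: V_def)
    qed (simp add: V_def empty)
    ultimately have "hausdorff_premeasure X s \<delta> (mspace X) \<le>
        (\<Sum>i. ennreal (enn2real (set_diameter X (V i)) powr s))"
      unfolding hausdorff_premeasure_def by (intro Inf_lower) blast
    also have "\<dots> = (\<Sum>i<card E. ennreal (enn2real (set_diameter X (V i)) powr s))"
      by (intro suminf_finite) (auto simp: V_def empty)
    also have "\<dots> \<le> (\<Sum>i<card E. ennreal (\<Delta> powr s * h powr (s - 1) * W (g i)))"
    proof (intro sum_mono ennreal_leI)
      fix i assume i: "i \<in> {..<card E}"
      then have w: "g i \<in> words N" "length (g i) = n" using gE by (auto simp: E_def)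
      have Wpos: "0 < W (g i)" by (rule W_pos[OF w(1)])
      have "enn2real (set_diameter X (V i)) \<le> \<Delta> * W (g i)"
        using i diam[OF w(1)] \<Delta>_ge_1 Wpos enn2real_mono[of _ "ennreal (\<Delta> * W (g i))"]
        by (simp add: V_def)
      then have "enn2real (set_diameter X (V i)) powr s \<le> (\<Delta> * W (g i)) powr s"
        using s by (intro powr_mono2) auto
      also have "\<dots> = \<Delta> powr s * (W (g i) powr (s - 1) * W (g i))"
        using \<Delta>_ge_1 Wpos powr_add[of "W (g i)" "s - 1" 1] by (simp add: powr_mult)
      also have "\<dots> \<le> \<Delta> powr s * (h powr (s - 1) * W (g i))"
        using n w Wpos s by (intro mult_left_mono mult_right_mono powr_mono2) (auto simp: less_imp_le)
      finally show "enn2real (set_diameter X (V i)) powr s \<le> \<Delta> powr s * h powr (s - 1) * W (g i)"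
        by (simp add: mult.assoc)
    qed
    also have "\<dots> = ennreal (\<Sum>i<card E. \<Delta> powr s * h powr (s - 1) * W (g i))"
      using gE by (intro sum_ennreal) (auto simp: E_def intro!: mult_nonneg_nonneg less_imp_le[OF W_pos])
    also have "(\<Sum>i<card E. \<Delta> powr s * h powr (s - 1) * W (g i)) =
        (\<Sum>w\<in>E. \<Delta> powr s * h powr (s - 1) * W w)"
      by (rule sum.reindex_bij_betw[OF g])
    also have "\<dots> \<le> \<Delta> powr s * h powr (s - 1) * W []"
      using sum_W_level_le[of n] by (simp add: E_def mult_left_mono flip: sum_distrib_left)
    also have "\<dots> = \<epsilon>" by (rule hs)
    finally show ?thesis by (simp add: ennreal_leI)
  qed
  then have "hausdorff_premeasure X s \<delta> (mspace X) = 0" if "0 < \<delta>" for \<delta>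
    using that by (metis ennreal_le_epsilon add_0 le_zero_eq)
  then show ?thesis unfolding hausdorff_outer_def by (simp add: bot_ennreal)
qed

lemma hausdorff_dim_le_1: "hausdorff_dim X (mspace X) \<le> 1"
proof (rule ennreal_le_epsilon)
  fix \<epsilon> :: real assume "0 < \<epsilon>"
  then have "hausdorff_dim X (mspace X) \<le> ennreal (1 + \<epsilon>)"
    unfolding hausdorff_dim_def using hausdorff_outer_0[of "1 + \<epsilon>"]
    by (intro Inf_lower CollectI exI[of _ "1 + \<epsilon>"] conjI) auto
  then show "hausdorff_dim X (mspace X) \<le> 1 + ennreal \<epsilon>"
    using \<open>0 < \<epsilon>\<close> by (simp add: ennreal_plus flip: ennreal_1)
qed

theorem minimal_dim_1:
  "minimal_for_conformal_dim X \<and> conformal_dim X = 1 \<and> hausdorff_dim X (mspace X) = 1"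
proof -
  have ge: "1 \<le> hausdorff_dim Y (f ` mspace X)" if "quasisymmetric_map X Y f" for Y :: "'a metric" and f
  proof -
    interpret quasisymmetric_tree X N C p lo W \<Delta> \<theta> \<sigma> \<tau> Y f
      by unfold_locales (rule that)
    show ?thesis by (rule hausdorff_dim_image_ge_1)
  qed
  have dim: "hausdorff_dim X (mspace X) = 1"
    using ge[OF quasisymmetric_map_id] hausdorff_dim_le_1 by (intro antisym) auto
  have "conformal_dim X \<le> hausdorff_dim X (id ` mspace X)"
    by (rule conformal_dim_le[OF quasisymmetric_map_id])
  moreover have "1 \<le> conformal_dim X"
    unfolding conformal_dim_def using ge by (intro Inf_greatest) auto
  ultimately have "conformal_dim X = 1" using dim by (intro antisym) auto
  then show ?thesis using dim by (simp add: minimal_for_conformal_dim_def)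
qed

end

section \<open>Lalley--Gatzouras systems\<close>

text \<open>The front letter is the map applied first. Thus the cylinder of \<open>k # w\<close>
  lies inside that of \<open>w\<close>, in accordance with words growing at the front.\<close>

fun word_scale :: "(nat \<Rightarrow> nat \<Rightarrow> real) \<Rightarrow> nat list \<Rightarrow> nat \<Rightarrow> real" where
  "word_scale T [] i = 1"
| "word_scale T (k # w) i = word_scale T w i * T k i"

fun word_shift :: "(nat \<Rightarrow> nat \<Rightarrow> real) \<Rightarrow> (nat \<Rightarrow> nat \<Rightarrow> real) \<Rightarrow> nat list \<Rightarrow> nat \<Rightarrow> real" where
  "word_shift T b [] i = 0"
| "word_shift T b (k # w) i = word_scale T w i * b k i + word_shift T b w i"

definition word_map ::
  "nat \<Rightarrow> (nat \<Rightarrow> nat \<Rightarrow> real) \<Rightarrow> (nat \<Rightarrow> nat \<Rightarrow> real) \<Rightarrow> nat list \<Rightarrow> (nat \<Rightarrow> real) \<Rightarrow> (nat \<Rightarrow> real)" where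
  "word_map d T b w = diag_map d (word_scale T w) (word_shift T b w)"

lemma word_map_Cons: "word_map d T b (k # w) x = word_map d T b w (diag_map d (T k) (b k) x)"
  by (auto simp: word_map_def diag_map_def fun_eq_iff algebra_simps)

lemma diag_map_coord_proj: "diag_map n t (coord_proj n c) = diag_map n t c"
  by (auto simp: diag_map_def coord_proj_def fun_eq_iff)

lemma finite_bound_less_1:
  assumes "finite F" "\<And>x. x \<in> F \<Longrightarrow> x < (1::real)"
  shows "\<exists>\<tau>. 0 < \<tau> \<and> \<tau> < 1 \<and> (\<forall>x\<in>F. x \<le> \<tau>)"
\<comment> \<open>The default 1/2 covers the empty set, which arises for the ratios of scales when
  \<open>d = 1\<close>.\<close>
proof (intro exI[of _ "Max (insert (1 / 2) F)"] conjI ballI)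
  show "0 < Max (insert (1 / 2) F)"
    using assms(1) Max_ge[of "insert (1 / 2) F" "1 / 2"] by simp
  show "Max (insert (1 / 2) F) < 1" using assms by (subst Max_less_iff) auto
qed (use assms(1) in auto)

lemma finite_bound_pos:
  assumes "finite F" "\<And>x. x \<in> F \<Longrightarrow> 0 < (x::real)"
  shows "\<exists>\<sigma>>0. \<forall>x\<in>F. \<sigma> \<le> x"
proof (intro exI[of _ "Min (insert 1 F)"] conjI ballI)
  show "0 < Min (insert 1 F)" using assms by (subst Min_gr_iff) auto
qed (use assms(1) in auto)

section \<open>Projection to the first coordinate\<close>

lemma compactin_coordinate_image:
  assumes "compactin (Euclidean_space n) K"
  shows "compact ((\<lambda>x. x i) ` K)"
proof -
  have "continuous_map (Euclidean_space n) euclidean (\<lambda>x. x i :: real)"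
    unfolding continuous_map_Euclidean_space_iff
    by (rule continuous_on_subset[OF continuous_on_product_coordinates]) simp
  from image_compactin[OF assms this] show ?thesis by simp
qed

text \<open>Pull \<open>t\<close> back through \<open>n\<close> maps, choose any point of
  \<open>J\<close> there and push it forward: it lands in \<open>J\<close> within
  \<open>\<tau> ^ n\<close> of \<open>t\<close>. Since \<open>J\<close> is closed, \<open>t\<close>
  belongs to it.\<close>

lemma self_similar_subset_eq_unit_interval:
  fixes J :: "real set"
  assumes J: "compact J" "J \<noteq> {}" "J \<subseteq> {0..1}"
    and inv: "\<And>k x. k \<in> I \<Longrightarrow> x \<in> J \<Longrightarrow> a k * x + c k \<in> J"
    and cover: "\<And>t. t \<in> {0..1} \<Longrightarrow> \<exists>k\<in>I. \<exists>s\<in>{0..1}. t = a k * s + c k"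
    and a: "\<And>k. k \<in> I \<Longrightarrow> 0 < a k \<and> a k \<le> \<tau>" and \<tau>: "0 < \<tau>" "\<tau> < 1"
  shows "J = {0..1}"
proof
  have approx: "\<exists>x\<in>J. \<bar>t - x\<bar> \<le> \<tau> ^ n" if "t \<in> {0..1}" for t n
    using that
  proof (induction n arbitrary: t)
    case 0
    obtain x where "x \<in> J" using J by blast
    moreover have "x \<in> {0..1}" using J(3) \<open>x \<in> J\<close> by blast
    ultimately show ?case using 0 by (intro bexI[of _ x]) auto
  next
    case (Suc n)
    obtain k s where k: "k \<in> I" "s \<in> {0..1}" "t = a k * s + c k" using cover[OF Suc.prems] by blast
    obtain x where x: "x \<in> J" "\<bar>s - x\<bar> \<le> \<tau> ^ n" using Suc.IH[OF k(2)] by blast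
    have "\<bar>t - (a k * x + c k)\<bar> = a k * \<bar>s - x\<bar>"
      using a[OF k(1)] by (simp add: k(3) abs_mult flip: right_diff_distrib)
    also have "\<dots> \<le> \<tau> * \<tau> ^ n" using a[OF k(1)] x \<tau> by (intro mult_mono) auto
    finally show ?case using inv[OF k(1) x(1)] by auto
  qed
  show "{0..1} \<subseteq> J"
  proof
    fix t :: real assume t: "t \<in> {0..1}"
    have "\<exists>x\<in>J. dist x t < e" if e: "0 < e" for e
    proof -
      obtain n where "\<tau> ^ n < e" using real_arch_pow_inv[OF e \<tau>(2)] by blast
      then show ?thesis using approx[OF t, of n] by (force simp: dist_real_def)
    qed
    then have "t \<in> closure J" by (simp add: closure_approachable)
    then show "t \<in> J" using compact_imp_closed[OF J(1)] by simp
  qed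
qed (rule J(3))

lemma coordinate_ordering_less_0:
  assumes "coordinate_ordering d N T" "k < N" "0 < i" "i < d"
  shows "T k i < T k 0"
  using assms(3,4)
proof (induction i)
  case (Suc i)
  have "T k (Suc i) < T k i" using assms Suc.prems by (simp add: coordinate_ordering_def)
  then show ?case using Suc by (cases "i = 0") auto
qed simp

theorem theorem1p4:
  fixes d N :: nat
    and T b :: "nat \<Rightarrow> nat \<Rightarrow> real"
    and K :: "(nat \<Rightarrow> real) set"
  assumes "lalley_gatzouras d N T b"
    and "is_attractor d (proj_IFS N T b d) K"
    and "K \<subseteq> closed_cube d"
    and "card (proj_IFS N T b 1) = N"
    and "is_attractor 1 (proj_IFS N T b 1) (closed_cube 1)"
    and "\<And>l u. 1 \<le> l \<Longrightarrow> l \<le> d - 1 \<Longrightarrow> u \<in> proj_IFS N T b l \<Longrightarrow> card (fiber_IFS N T b l u) = 1"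
  shows "minimal_for_conformal_dim (submetric (Rn_metric d) K) \<and>
    conformal_dim (submetric (Rn_metric d) K) = 1 \<and>
    hausdorff_dim (submetric (Rn_metric d) K) K = 1"
proof -
  have d: "1 \<le> d" and N: "1 \<le> N" and T: "\<And>k i. k < N \<Longrightarrow> i < d \<Longrightarrow> 0 < T k i \<and> T k i < 1"
    and ord: "coordinate_ordering d N T" and neat: "neat_projection d N T b"
    using assms(1) by (auto simp: lalley_gatzouras_def diagonal_IFS_def)
  have K: "K \<noteq> {}" "compactin (Euclidean_space d) K" "K = (\<Union>k<N. diag_map d (T k) (b k) ` K)"
    using assms(2) by (auto simp: is_attractor_def proj_IFS_def diag_map_coord_proj)
  have K_cube: "0 \<le> x i" "x i \<le> 1" if "x \<in> K" "i < d" for x i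
    using assms(3) that by (auto simp: closed_cube_def)
  have K_top: "K \<subseteq> topspace (Euclidean_space d)" using assms(3) by (auto simp: closed_cube_def)
  define X where "X = submetric (Rn_metric d) K"
  have X: "mspace X = K" "mdist X = (\<lambda>x y. L2_set (\<lambda>i. x i - y i) {..<d})"
    using K_top by (auto simp: X_def)
  obtain \<sigma> where \<sigma>: "0 < \<sigma>" "\<forall>t\<in>(\<lambda>k. T k 0) ` {..<N}. \<sigma> \<le> t"
    using finite_bound_pos[of "(\<lambda>k. T k 0) ` {..<N}"] T d by force
  obtain \<tau> where \<tau>: "0 < \<tau>" "\<tau> < 1" "\<forall>t\<in>(\<lambda>k. T k 0) ` {..<N}. t \<le> \<tau>"
    using finite_bound_less_1[of "(\<lambda>k. T k 0) ` {..<N}"] T d by force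
  \<comment> \<open>The coordinate ordering enters through these ratios: finitely many numbers below
    1, bounded by a common \<open>\<theta> < 1\<close>.\<close>
  define F where "F = (\<lambda>(k, i). T k i / T k 0) ` ({..<N} \<times> {0<..<d})"
  have "t < 1" if "t \<in> F" for t
    using that T d coordinate_ordering_less_0[OF ord] by (auto simp: F_def)
  then obtain \<theta> where \<theta>: "0 < \<theta>" "\<theta> < 1" "\<forall>t\<in>F. t \<le> \<theta>"
    using finite_bound_less_1[of F] by (auto simp: F_def)
  have T_\<theta>: "T k i \<le> \<theta> * T k 0" if "k < N" "0 < i" "i < d" for k i
  proof -
    have "T k i / T k 0 \<in> F" using that by (auto simp: F_def)
    then have "T k i / T k 0 \<le> \<theta>" using \<theta> by blast
    moreover have "0 < T k 0" using T[of k 0] that by auto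
    ultimately show ?thesis by (simp add: pos_divide_le_eq)
  qed

  \<comment> \<open>Estimates for compositions along words\<close>
  define W where "W w = word_scale T w 0" for w
  define lo where "lo w = word_shift T b w 0" for w
  define C where "C w = word_map d T b w ` K" for w
  have W_pos: "0 < W w" if "w \<in> words N" for w
    using that unfolding W_def by (induction w) (use T d in auto)
  have scale_pos: "0 < word_scale T w i" if "w \<in> words N" "i < d" for w i
    using that by (induction w) (use T in auto)
  have scale_\<theta>: "word_scale T w i \<le> \<theta> ^ length w * W w" if "w \<in> words N" "0 < i" "i < d" for w i
    using that
  proof (induction w)
    case (Cons k w)
    then have IH: "word_scale T w i \<le> \<theta> ^ length w * W w" by simp
    have "word_scale T w i * T k i \<le> (\<theta> ^ length w * W w) * (\<theta> * T k 0)"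
    proof (rule mult_mono[OF IH])
      show "T k i \<le> \<theta> * T k 0" "0 \<le> T k i"
        using T_\<theta>[of k i] T[of k i] Cons.prems by auto
      show "0 \<le> \<theta> ^ length w * W w" using \<theta> W_pos[of w] Cons.prems by auto
    qed
    then show ?case by (simp add: W_def mult_ac)
  qed (simp add: W_def)
  have scale_W: "word_scale T w i \<le> W w" if "w \<in> words N" "i < d" for w i
  proof (cases "i = 0")
    case False
    have "word_scale T w i \<le> \<theta> ^ length w * W w" using scale_\<theta> that False by simp
    also have "\<dots> \<le> 1 * W w"
      using \<theta> W_pos[OF that(1)] by (intro mult_right_mono power_le_one) auto
    finally show ?thesis by simp
  qed (simp add: W_def)
  have diff_le: "\<bar>word_map d T b w x i - word_map d T b w y i\<bar> \<le> word_scale T w i"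
    if "w \<in> words N" "x \<in> K" "y \<in> K" "i < d" for w x y i
  proof -
    have "word_map d T b w x i - word_map d T b w y i = word_scale T w i * (x i - y i)"
      using that by (simp add: word_map_def diag_map_def algebra_simps)
    also have "\<bar>\<dots>\<bar> = word_scale T w i * \<bar>x i - y i\<bar>"
      using scale_pos[OF that(1,4)] by (simp add: abs_mult)
    also have "\<dots> \<le> word_scale T w i * 1"
      using K_cube[OF that(2,4)] K_cube[OF that(3,4)] scale_pos[OF that(1,4)]
      by (intro mult_left_mono) (auto simp: abs_le_iff)
    finally show ?thesis by simp
  qed
  \<comment> \<open>The projection of \<open>K\<close> is compact and invariant under the root maps,
    and these cover \<open>[0,1]\<close> because it is their attractor.\<close>
  have p_K: "(\<lambda>x. x 0) ` K = {0..1}"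
  proof (rule self_similar_subset_eq_unit_interval[where I = "{..<N}" and a = "\<lambda>k. T k 0" and c = "\<lambda>k. b k 0"])
    show "compact ((\<lambda>x. x 0) ` K)" by (rule compactin_coordinate_image[OF K(2)])
    show "(\<lambda>x. x 0) ` K \<subseteq> {0..1}" using K_cube d by fastforce
    show "T k 0 * t + b k 0 \<in> (\<lambda>x. x 0) ` K" if k: "k \<in> {..<N}" and t: "t \<in> (\<lambda>x. x 0) ` K" for k t
    proof -
      obtain x where x: "x \<in> K" "t = x 0" using t by blast
      have "diag_map d (T k) (b k) x \<in> K" using x k by (subst K(3)) auto
      moreover have "diag_map d (T k) (b k) x 0 = T k 0 * t + b k 0" using d x by (simp add: diag_map_def)
      ultimately show ?thesis by (metis imageI)
    qed
    show "\<exists>k\<in>{..<N}. \<exists>s\<in>{0..1}. t = T k 0 * s + b k 0" if t: "t \<in> {0..1}" for t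
    proof -
      define x where "x = (\<lambda>i::nat. if i = 0 then t else 0)"
      have "x \<in> closed_cube 1" using t by (auto simp: closed_cube_def x_def topspace_Euclidean_space)
      also have "closed_cube 1 = (\<Union>k<N. diag_map 1 (T k) (b k) ` closed_cube 1)"
        using assms(5) by (simp add: is_attractor_def proj_IFS_def diag_map_coord_proj)
      finally obtain k y where k: "k < N" "y \<in> closed_cube 1" "x = diag_map 1 (T k) (b k) y" by blast
      have "t = T k 0 * y 0 + b k 0" using fun_cong[OF k(3), of 0] by (simp add: x_def diag_map_def)
      moreover have "y 0 \<in> {0..1}" using k(2) by (simp add: closed_cube_def)
      ultimately show ?thesis using k(1) by blast
    qed
    show "0 < T k 0 \<and> T k 0 \<le> \<tau>" if "k \<in> {..<N}" for k using that T[of k 0] d \<tau> by auto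
  qed (use K \<tau> in auto)
  \<comment> \<open>Cardinality \<open>N\<close> means that distinct indices give distinct root
    maps, so the neat projection condition in dimension 1 separates all of them.\<close>
  have inj: "inj_on (\<lambda>k. diag_map 1 (T k) (b k)) {..<N}"
    using assms(4) by (intro eq_card_imp_inj_on) (simp_all add: proj_IFS_def diag_map_coord_proj)
  have fam: "disjoint_family_on (\<lambda>f. f ` open_cube 1) ((\<lambda>k. diag_map 1 (T k) (b k)) ` {..<N})"
    using neat d by (auto simp: neat_projection_def proj_IFS_def diag_map_coord_proj)
  have disj: "diag_map 1 (T j) (b j) ` open_cube 1 \<inter> diag_map 1 (T k) (b k) ` open_cube 1 = {}"
    if "j < N" "k < N" "j \<noteq> k" for j k
  proof (rule disjoint_family_onD[OF fam])
    show "diag_map 1 (T j) (b j) \<noteq> diag_map 1 (T k) (b k)"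
      using inj_onD[OF inj, of j k] that by blast
  qed (use that in auto)
  have in_image: "(\<lambda>i. if i = 0 then t else 0) \<in> diag_map 1 (T k) (b k) ` open_cube 1"
    if "k < N" "b k 0 < t" "t < b k 0 + T k 0" for k t
  proof (rule image_eqI)
    define y where "y = (\<lambda>i::nat. if i = 0 then (t - b k 0) / T k 0 else 0)"
    have pos: "0 < T k 0" using T[of k 0] that d by auto
    show "(\<lambda>i. if i = 0 then t else 0) = diag_map 1 (T k) (b k) y"
      using pos by (auto simp: diag_map_def y_def fun_eq_iff)
    show "y \<in> open_cube 1"
      using pos that by (auto simp: open_cube_def y_def topspace_Euclidean_space pos_divide_less_eq)
  qed
  \<comment> \<open>The constant \<open>\<Delta>\<close> is \<open>d\<close>: the Euclidean distance
    is at most the sum of the \<open>d\<close> coordinate differences, each bounded by a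
    width.\<close>
  have tree: "cylinder_tree X N C (\<lambda>x. x 0) lo W (real d) \<theta> \<sigma> \<tau>"
  proof
    show "compactin (mtopology_of X) (mspace X)"
      using K(2) by (simp add: X(1)) (simp add: X_def mtopology_of_submetric mtopology_of_Rn compactin_subtopology)
    show "C [] = mspace X"
    proof -
      have "word_map d T b [] x = x" if "x \<in> K" for x
        using K_top that by (fastforce simp: word_map_def diag_map_def fun_eq_iff topspace_Euclidean_space)
      then show ?thesis by (simp add: C_def X)
    qed
    show "C w = (\<Union>k<N. C (k # w))" for w
    proof -
      have "C w = word_map d T b w ` (\<Union>k<N. diag_map d (T k) (b k) ` K)" unfolding C_def using K(3) by simp
      also have "\<dots> = (\<Union>k<N. C (k # w))"
        by (simp add: C_def image_UN image_image word_map_Cons)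
      finally show ?thesis .
    qed
    show "(\<lambda>x. x 0) ` C w = {lo w..lo w + W w}" if w: "w \<in> words N" for w
    proof -
      have "(\<lambda>x. x 0) ` C w = (\<lambda>t. W w * t + lo w) ` ((\<lambda>x. x 0) ` K)"
        using d by (simp add: C_def image_image word_map_def diag_map_def W_def lo_def)
      also have "\<dots> = {lo w..lo w + W w}"
        unfolding p_K image_affinity_atLeastAtMost using W_pos[OF w] by (simp add: add.commute)
      finally show ?thesis .
    qed
    show "\<sigma> * W w \<le> W (k # w)" if "w \<in> words N" "k < N" for w k
      using \<sigma> that W_pos[of w] by (simp add: W_def mult.commute mult_left_mono)
    show "W (k # w) \<le> \<tau> * W w" if "w \<in> words N" "k < N" for w k
      using \<tau> that W_pos[of w] by (simp add: W_def mult.commute mult_left_mono)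
    show "\<bar>x 0 - y 0\<bar> \<le> mdist X x y" for x y
      using member_le_L2_set[of "{..<d}" 0 "\<lambda>i. \<bar>x i - y i\<bar>"] d by (simp add: X L2_set_def)
    show "mdist X x y \<le> real d * W w" if w: "w \<in> words N" and xy: "x \<in> C w" "y \<in> C w" for w x y
    proof -
      obtain x' y' where *: "x' \<in> K" "y' \<in> K" "x = word_map d T b w x'" "y = word_map d T b w y'"
        using xy by (auto simp: C_def)
      have "mdist X x y \<le> (\<Sum>i<d. \<bar>x i - y i\<bar>)" by (simp add: X L2_set_le_sum_abs)
      also have "\<dots> \<le> (\<Sum>i<d. W w)"
        using diff_le[OF w *(1,2)] scale_W[OF w] by (intro sum_mono) (force simp: *(3,4) intro: order_trans)
      finally show ?thesis by simp
    qed
    show "mdist X x y \<le> real d * \<theta> ^ length w * W w"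
      if w: "w \<in> words N" and xy: "x \<in> C w" "y \<in> C w" "x 0 = y 0" for w x y
    proof -
      obtain x' y' where *: "x' \<in> K" "y' \<in> K" "x = word_map d T b w x'" "y = word_map d T b w y'"
        using xy by (auto simp: C_def)
      have "mdist X x y \<le> (\<Sum>i<d. \<bar>x i - y i\<bar>)" by (simp add: X L2_set_le_sum_abs)
      also have "\<dots> \<le> (\<Sum>i<d. \<theta> ^ length w * W w)"
      proof (rule sum_mono)
        fix i assume i: "i \<in> {..<d}"
        show "\<bar>x i - y i\<bar> \<le> \<theta> ^ length w * W w"
        proof (cases "i = 0")
          case True
          then show ?thesis using xy(3) \<theta> W_pos[OF w] by simp
        next
          case False
          have "\<bar>x i - y i\<bar> \<le> word_scale T w i" unfolding *(3,4) using diff_le[OF w *(1,2)] i by simp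
          also have "\<dots> \<le> \<theta> ^ length w * W w" using scale_\<theta>[OF w] i False by simp
          finally show ?thesis .
        qed
      qed
      finally show ?thesis by simp
    qed
    show "{lo (j # w)<..<lo (j # w) + W (j # w)} \<inter> {lo (k # w)<..<lo (k # w) + W (k # w)} = {}"
      if w: "w \<in> words N" and jk: "j < N" "k < N" "j \<noteq> k" for w j k
    proof -
      \<comment> \<open>Undoing the affine map of \<open>w\<close> carries the intervals of its
        children to those of the root maps.\<close>
      have eq: "{lo (i # w)<..<lo (i # w) + W (i # w)} = {t. b i 0 < (t - lo w) / W w \<and> (t - lo w) / W w < b i 0 + T i 0}" for i
        using W_pos[OF w]
        by (auto simp: lo_def W_def pos_less_divide_eq pos_divide_less_eq algebra_simps)
      show ?thesis unfolding eq using in_image[OF jk(1)] in_image[OF jk(2)] disj[OF jk] by blast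
    qed
  qed (use \<sigma> \<tau> \<theta> in \<open>simp_all add: W_def\<close>)
  show ?thesis
    using cylinder_tree.minimal_dim_1[OF tree] unfolding X(1) unfolding X_def .
qed

end
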